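(* Let $K$ be any field and let $E$ be any directed graph. Let $p$ be an irrational infinite path in $E$ such that no vertex of $p$ is an infinite emitter, and let $v=s(p)$. Let $\rho_p:L_K(E)v\to V_{[p]}$ be the map $r\mapsto r\cdot p$. For each $i\ge 0$ let $J_i(p)=\sum_{f\in X_i(p)}L_K(E)f^*p_i^*$. Then $$\operatorname{Ker}(\rho_p)=\bigoplus_{i=0}^{\infty}J_i(p)$$ (an internal direct sum of left ideals of $L_K(E)$).
   Context: A directed graph $E=(E^0,E^1,s,r)$ consists of a set $E^0$ of vertices, a set $E^1$ of edges, and maps $s,r:E^1\to E^0$ (source and range). An infinite emitter is a vertex $u$ with $s^{-1}(u)$ infinite. A path of length $n\ge 1$ is a sequence $\alpha=e_1\cdots e_n$ of edges with $r(e_i)=s(e_{i+1})$; vertices are the paths of length $0$. A path of length $\ge1$ is closed if its source equals its range. The Leavitt path algebra $L_K(E)$ is the $K$-algebra generated by $\{v: v\in E^0\}\cup\{e,e^*: e\in E^1\}$ with relations: (V) $vu=\delta_{v,u}v$ for $v,u\in E^0$; (E1) $s(e)e=er(e)=e$; (E2) $r(e)e^*=e^*s(e)=e^*$ for $e\in E^1$; (CK1) $e^*e'=\delta_{e,e'}r(e)$ for $e,e'\in E^1$; (CK2) $v=\sum_{e\in s^{-1}(v)}ee^*$ for every $v\in E^0$ with $0<|s^{-1}(v)|<\infty$. For a path $\beta=e_1\cdots e_n$, $\beta^*=e_n^*\cdots e_1^*$, and $v^*=v$ for a vertex. An infinite path is a sequence $p=e_1e_2e_3\cdots$ of edges with $r(e_i)=s(e_{i+1})$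 for all $i$; $s(p)=s(e_1)$, $\tau_{>n}(p)=e_{n+1}e_{n+2}\cdots$. Infinite paths $p,q$ are tail equivalent ($p\sim q$) if $\tau_{>m}(p)=\tau_{>n}(q)$ for some $m,n\ge0$; $[p]$ is the class of $p$. An infinite path is rational if it is tail equivalent to $c^\infty=ccc\cdots$ for some closed path $c$, and irrational otherwise. The Chen simple module $V_{[p]}$ is the $K$-vector space with basis $[p]$ and left $L_K(E)$-action determined, for $q=f_1f_2\cdots\in[p]$, $v\in E^0$, $e\in E^1$, by: $v\cdot q=q$ if $v=s(f_1)$ and $0$ otherwise; $e\cdot q=eq$ if $r(e)=s(f_1)$ and $0$ otherwise; $e^*\cdot q=\tau_{>1}(q)$ if $e=f_1$ and $0$ otherwise. For $p=e_1e_2\cdots$ put $p_0=s(e_1)$, $p_i=e_1\cdots e_i$ for $i\geq 1$, and $X_i(p)=\{f\in E^1: s(f)=s(e_{i+1}),\ f\ne e_{i+1}\}$ for $i\ge 0$. (An empty sum is $\{0\}$.) *)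

theory Defs
  imports
    "HOL-Algebra.QuotRing"
    "HOL-Algebra.Module"
    "HOL-Library.Poly_Mapping"
    "HOL-Library.Stream"
    "Graph_Theory.Arc_Walk"
begin

text \<open>
  A directed graph is a \<^locale>\<open>wf_digraph\<close>: \<^const>\<open>tail\<close> is the source map, \<^const>\<open>head\<close> the
  range map, and loops, parallel arcs and infinitely many vertices or arcs are allowed.
  The field $K$ is an arbitrary type of class \<^class>\<open>field\<close>.
\<close>

section \<open>Infinite paths\<close>

definition infinite_emitter :: "('v, 'e) pre_digraph \<Rightarrow> 'v \<Rightarrow> bool" where
  "infinite_emitter E u \<longleftrightarrow> u \<in> verts E \<and> infinite (out_arcs E u)"

definition closed_path :: "('v, 'e) pre_digraph \<Rightarrow> 'e list \<Rightarrow> bool" where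
  "closed_path E c \<longleftrightarrow> c \<noteq> [] \<and> (\<exists>u. pre_digraph.awalk E u c u)"

text \<open>Streams are indexed from 0, so \<open>p !! i\<close> is the edge $e_{i+1}$ of $p = e_1 e_2 \cdots$,
  \<open>stake i p\<close> is $e_1 \cdots e_i$, and \<open>sdrop n p\<close> is $\tau_{>n}(p)$.\<close>

definition infinite_path :: "('v, 'e) pre_digraph \<Rightarrow> 'e stream \<Rightarrow> bool" where
  "infinite_path E p \<longleftrightarrow>
     (\<forall>i. p !! i \<in> arcs E \<and> head E (p !! i) = tail E (p !! Suc i))"

definition path_source :: "('v, 'e) pre_digraph \<Rightarrow> 'e stream \<Rightarrow> 'v" where
  "path_source E p = tail E (shd p)"

definition tail_equivalent :: "'e stream \<Rightarrow> 'e stream \<Rightarrow> bool" where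
  "tail_equivalent p q \<longleftrightarrow> (\<exists>m n. sdrop m p = sdrop n q)"

definition tail_class :: "('v, 'e) pre_digraph \<Rightarrow> 'e stream \<Rightarrow> 'e stream set" where
  "tail_class E p = {q. infinite_path E q \<and> tail_equivalent p q}"

definition rational :: "('v, 'e) pre_digraph \<Rightarrow> 'e stream \<Rightarrow> bool" where
  "rational E p \<longleftrightarrow>
     infinite_path E p \<and> (\<exists>c. closed_path E c \<and> tail_equivalent p (cycle c))"

definition irrational :: "('v, 'e) pre_digraph \<Rightarrow> 'e stream \<Rightarrow> bool" where
  "irrational E p \<longleftrightarrow> infinite_path E p \<and> \<not> rational E p"

section \<open>The Leavitt path algebra\<close>

datatype ('v, 'e) lpa_gen = Vert 'v | Edge 'e | Ghost 'e

definition lpa_gens :: "('v, 'e) pre_digraph \<Rightarrow> ('v, 'e) lpa_gen set" where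
  "lpa_gens E = Vert ` verts E \<union> Edge ` arcs E \<union> Ghost ` arcs E"

datatype 'g free_word = Word "'g list"

text \<open>The free monoid, written additively because \<^typ>\<open>'m \<Rightarrow>\<^sub>0 'k\<close> is a ring under
  convolution when \<open>'m\<close> is an additive monoid. Thus \<^typ>\<open>'g free_word \<Rightarrow>\<^sub>0 'k\<close> is the free
  unital associative algebra on \<open>'g\<close>.\<close>

instantiation free_word :: (type) monoid_add
begin

definition zero_free_word :: "'a free_word" where
  "0 = Word []"

fun plus_free_word :: "'a free_word \<Rightarrow> 'a free_word \<Rightarrow> 'a free_word" where
  "Word xs + Word ys = Word (xs @ ys)"

instance
proof
  fix a b c :: "'a free_word"
  show "a + b + c = a + (b + c)"
    by (cases a; cases b; cases c) simp
  show "0 + a = a" "a + 0 = a"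
    by (cases a; simp add: zero_free_word_def)+
qed

end

type_synonym ('v, 'e, 'k) lpa_poly = "('v, 'e) lpa_gen free_word \<Rightarrow>\<^sub>0 'k"

text \<open>Elements of $L_K(E)$ are cosets in the free algebra.\<close>
type_synonym ('v, 'e, 'k) lpa_elem = "('v, 'e, 'k) lpa_poly set"

definition scale :: "'k::field \<Rightarrow> ('a \<Rightarrow>\<^sub>0 'k) \<Rightarrow> ('a \<Rightarrow>\<^sub>0 'k)" where
  "scale c x = Poly_Mapping.map ((*) c) x"

definition monomial :: "('v, 'e) lpa_gen list \<Rightarrow> ('v, 'e, 'k::field) lpa_poly" where
  "monomial gs = Poly_Mapping.single (Word gs) 1"

text \<open>The free non-unital $K$-algebra on the generators. Like $L_K(E)$ below it is packaged as a
  \<^typ>\<open>('k, 'a) module\<close> record; these algebras need not have a unit, so the field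
  \<^const>\<open>one\<close> carries no meaning.\<close>

definition free_alg ::
  "('v, 'e) pre_digraph \<Rightarrow> ('k::field, ('v, 'e, 'k) lpa_poly) module" where
  "free_alg E =
    \<lparr>carrier = {x. Poly_Mapping.keys x \<subseteq> {Word gs |gs. gs \<noteq> [] \<and> set gs \<subseteq> lpa_gens E}},
     mult = (*), one = undefined, zero = 0, add = (+), smult = scale\<rparr>"

text \<open>An element \<open>x\<close> of this set stands for the relation \<open>x = 0\<close>.\<close>

inductive_set lpa_relations ::
  "('v, 'e) pre_digraph \<Rightarrow> ('v, 'e, 'k::field) lpa_poly set"
  for E :: "('v, 'e) pre_digraph" where
  V: "v \<in> verts E \<Longrightarrow> u \<in> verts E \<Longrightarrow>
      monomial [Vert v, Vert u] - (if v = u then monomial [Vert v] else 0) \<in> lpa_relations E"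
| E1_source: "e \<in> arcs E \<Longrightarrow>
      monomial [Vert (tail E e), Edge e] - monomial [Edge e] \<in> lpa_relations E"
| E1_range: "e \<in> arcs E \<Longrightarrow>
      monomial [Edge e, Vert (head E e)] - monomial [Edge e] \<in> lpa_relations E"
| E2_range: "e \<in> arcs E \<Longrightarrow>
      monomial [Vert (head E e), Ghost e] - monomial [Ghost e] \<in> lpa_relations E"
| E2_source: "e \<in> arcs E \<Longrightarrow>
      monomial [Ghost e, Vert (tail E e)] - monomial [Ghost e] \<in> lpa_relations E"
| CK1: "e \<in> arcs E \<Longrightarrow> e' \<in> arcs E \<Longrightarrow>
      monomial [Ghost e, Edge e'] - (if e = e' then monomial [Vert (head E e)] else 0)
        \<in> lpa_relations E"
| CK2: "v \<in> verts E \<Longrightarrow> out_arcs E v \<noteq> {} \<Longrightarrow> finite (out_arcs E v) \<Longrightarrow>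
      monomial [Vert v] - (\<Sum>e\<in>out_arcs E v. monomial [Edge e, Ghost e]) \<in> lpa_relations E"

text \<open>The two-sided algebra ideal of \<^term>\<open>free_alg E\<close> generated by the relations.\<close>

inductive_set lpa_ideal ::
  "('v, 'e) pre_digraph \<Rightarrow> ('v, 'e, 'k::field) lpa_poly set"
  for E :: "('v, 'e) pre_digraph" where
  relation: "x \<in> lpa_relations E \<Longrightarrow> x \<in> lpa_ideal E"
| zero: "0 \<in> lpa_ideal E"
| add: "x \<in> lpa_ideal E \<Longrightarrow> y \<in> lpa_ideal E \<Longrightarrow> x + y \<in> lpa_ideal E"
| scale: "x \<in> lpa_ideal E \<Longrightarrow> scale c x \<in> lpa_ideal E"
| left_mult: "a \<in> carrier (free_alg E) \<Longrightarrow> x \<in> lpa_ideal E \<Longrightarrow> a * x \<in> lpa_ideal E"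
| right_mult: "x \<in> lpa_ideal E \<Longrightarrow> a \<in> carrier (free_alg E) \<Longrightarrow> x * a \<in> lpa_ideal E"

text \<open>The quotient of \<^term>\<open>free_alg E\<close> by \<^term>\<open>lpa_ideal E\<close>, as in \<^const>\<open>FactRing\<close>.\<close>

definition lpa :: "('v, 'e) pre_digraph \<Rightarrow> ('k::field, ('v, 'e, 'k) lpa_elem) module" where
  "lpa E =
    \<lparr>carrier = a_rcosets\<^bsub>free_alg E\<^esub> (lpa_ideal E),
     mult = rcoset_mult (free_alg E) (lpa_ideal E),
     one = undefined,
     zero = lpa_ideal E,
     add = set_add (free_alg E),
     smult = (\<lambda>c A. \<Union>a\<in>A. lpa_ideal E +>\<^bsub>free_alg E\<^esub> scale c a)\<rparr>"

text \<open>The product in $L_K(E)$ of a nonempty list of generators.\<close>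

definition lpa_word ::
  "('v, 'e) pre_digraph \<Rightarrow> ('v, 'e) lpa_gen list \<Rightarrow> ('v, 'e, 'k::field) lpa_elem" where
  "lpa_word E gs = lpa_ideal E +>\<^bsub>free_alg E\<^esub> monomial gs"

text \<open>The words of generators spelling $\beta^* = e_n^* \cdots e_1^*$, for the path $\beta$ with
  source \<open>u\<close> and edges \<open>es\<close>; the source matters only for the path \<open>u\<close> of length 0, where
  $u^* = u$.\<close>

definition star_word :: "'v \<Rightarrow> 'e list \<Rightarrow> ('v, 'e) lpa_gen list" where
  "star_word u es = (if es = [] then [Vert u] else rev (map Ghost es))"

section \<open>Chen modules\<close>

definition lin_ext :: "('b \<Rightarrow> ('c \<Rightarrow>\<^sub>0 'k)) \<Rightarrow> ('b \<Rightarrow>\<^sub>0 'k::field) \<Rightarrow> ('c \<Rightarrow>\<^sub>0 'k)" where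
  "lin_ext f x = (\<Sum>b\<in>Poly_Mapping.keys x. scale (Poly_Mapping.lookup x b) (f b))"

fun gen_act ::
  "('v, 'e) pre_digraph \<Rightarrow> ('v, 'e) lpa_gen \<Rightarrow> 'e stream \<Rightarrow> ('e stream \<Rightarrow>\<^sub>0 'k::field)" where
  "gen_act E (Vert v) q = (if v = path_source E q then Poly_Mapping.single q 1 else 0)"
| "gen_act E (Edge e) q =
     (if head E e = path_source E q then Poly_Mapping.single (e ## q) 1 else 0)"
| "gen_act E (Ghost e) q = (if e = shd q then Poly_Mapping.single (stl q) 1 else 0)"

fun word_act :: "('v, 'e) pre_digraph \<Rightarrow> ('v, 'e) lpa_gen free_word \<Rightarrow>
    ('e stream \<Rightarrow>\<^sub>0 'k) \<Rightarrow> ('e stream \<Rightarrow>\<^sub>0 'k::field)" where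
  "word_act E (Word gs) x = foldr (\<lambda>g. lin_ext (gen_act E g)) gs x"

definition poly_act :: "('v, 'e) pre_digraph \<Rightarrow> ('v, 'e, 'k) lpa_poly \<Rightarrow>
    ('e stream \<Rightarrow>\<^sub>0 'k) \<Rightarrow> ('e stream \<Rightarrow>\<^sub>0 'k::field)" where
  "poly_act E a x = lin_ext (\<lambda>w. word_act E w x) a"

text \<open>$V_{[p]}$ as a left module over $L_K(E)$, acting through \<^const>\<open>smult\<close>; the ring
  multiplication of the record is unused. A coset acts by the common value of the actions of its
  representatives.\<close>

definition chen_module ::
  "('v, 'e) pre_digraph \<Rightarrow> 'e stream \<Rightarrow>
     (('v, 'e, 'k::field) lpa_elem, 'e stream \<Rightarrow>\<^sub>0 'k) module" where
  "chen_module E p =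
    \<lparr>carrier = {x. Poly_Mapping.keys x \<subseteq> tail_class E p},
     mult = undefined, one = undefined, zero = 0, add = (+),
     smult = (\<lambda>A x. the_elem ((\<lambda>a. poly_act E a x) ` A))\<rparr>"

section \<open>Left ideals and their sums\<close>

text \<open>For any element \<open>a\<close> of an algebra \<open>L\<close>, \<^term>\<open>PIdl\<^bsub>L\<^esub> a\<close> is literally the set
  \<open>{r \<otimes>\<^bsub>L\<^esub> a |r. r \<in> carrier L}\<close>, i.e. $La$.\<close>

definition left_ideal :: "('k, 'a) module \<Rightarrow> 'a set \<Rightarrow> bool" where
  "left_ideal L I \<longleftrightarrow> additive_subgroup I L \<and>
     (\<forall>c. \<forall>x\<in>I. c \<odot>\<^bsub>L\<^esub> x \<in> I) \<and> (\<forall>r\<in>carrier L. \<forall>x\<in>I. r \<otimes>\<^bsub>L\<^esub> x \<in> I)"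

definition ideal_sum :: "('k, 'a) module \<Rightarrow> 'i set \<Rightarrow> ('i \<Rightarrow> 'a set) \<Rightarrow> 'a set" where
  "ideal_sum L A J =
     {\<Oplus>\<^bsub>L\<^esub>i\<in>B. g i |B g. finite B \<and> B \<subseteq> A \<and> (\<forall>i\<in>B. g i \<in> J i)}"

definition internal_direct_sum ::
  "('k, 'a) module \<Rightarrow> 'a set \<Rightarrow> 'i set \<Rightarrow> ('i \<Rightarrow> 'a set) \<Rightarrow> bool" where
  "internal_direct_sum L M A J \<longleftrightarrow>
     (\<forall>i\<in>A. left_ideal L (J i)) \<and> M = ideal_sum L A J \<and>
     (\<forall>i\<in>A. J i \<inter> ideal_sum L (A - {i}) J = {\<zero>\<^bsub>L\<^esub>})"

section \<open>The kernel of \<open>\<rho>\<^sub>p\<close> and the left ideals \<open>J\<^sub>i(p)\<close>\<close>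

definition rho :: "('v, 'e) pre_digraph \<Rightarrow> 'e stream \<Rightarrow>
    ('v, 'e, 'k::field) lpa_elem \<Rightarrow> ('e stream \<Rightarrow>\<^sub>0 'k)" where
  "rho E p r = r \<odot>\<^bsub>chen_module E p\<^esub> Poly_Mapping.single p 1"

text \<open>The kernel of \<^const>\<open>rho\<close> on the left ideal $L_K(E)v$, $v = s(p)$.\<close>

definition ker_rho ::
  "('v, 'e) pre_digraph \<Rightarrow> 'e stream \<Rightarrow> ('v, 'e, 'k::field) lpa_elem set" where
  "ker_rho E p =
     a_kernel (lpa E\<lparr>carrier := PIdl\<^bsub>lpa E\<^esub> (lpa_word E [Vert (path_source E p)])\<rparr>)
       (chen_module E p) (rho E p)"

definition X_edges :: "('v, 'e) pre_digraph \<Rightarrow> 'e stream \<Rightarrow> nat \<Rightarrow> 'e set" where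
  "X_edges E p i = {f \<in> arcs E. tail E f = tail E (p !! i) \<and> f \<noteq> p !! i}"

definition J_ideal ::
  "('v, 'e) pre_digraph \<Rightarrow> 'e stream \<Rightarrow> nat \<Rightarrow> ('v, 'e, 'k::field) lpa_elem set" where
  "J_ideal E p i = ideal_sum (lpa E) (X_edges E p i)
     (\<lambda>f. PIdl\<^bsub>lpa E\<^esub>
        (lpa_word E [Ghost f] \<otimes>\<^bsub>lpa E\<^esub> lpa_word E (star_word (path_source E p) (stake i p))))"

end

theory Submission
  imports Defs
begin

text \<open>
  Let $a \in L_K(E)$. Applying (CK2) at the range of $p_n$ rewrites $p_n p_n^*$ as
  $p_{n+1} p_{n+1}^* + \sum_{f \in X_n(p)} p_n f f^* p_n^*$, so $a v$ is congruent to
  $a p_n p_n^*$ modulo $\sum_{i<n} J_i(p)$. For $n$ larger than the length of every monomial of $a$,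
  the product $a p_n$ is a linear combination of real paths $\gamma$ with $a \cdot p$ the
  corresponding combination of the infinite paths $\gamma \tau_{>n}(p)$. Irrationality makes
  these infinite paths distinct for distinct $\gamma$, so $a \cdot p = 0$ forces $a p_n = 0$.
  The sum is direct because the $p_i f f^* p_i^*$ with $f \in X_i(p)$ are orthogonal idempotents.
\<close>

section \<open>Linear maps on free modules\<close>

text \<open>Ghost edges disappear from $a p_n$ because each letter of a word uses up at most one
  edge of $p_n$: a ghost either cancels the first edge by (CK1) or annihilates the product. Taking
  $n$ larger than the word length leaves an edge that absorbs every vertex produced on the way.

  Linear independence of paths in $L_K(E)$, hence a normal form, is avoided. For $p = ccc...$ the
  argument breaks: $c - s(c)$ kills $p$, yet $c p_n$ and $p_n$ are different elements for every $n$.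

  The hypothesis on infinite emitters makes (CK2) available at every vertex of $p$. The easy
  inclusion holds because $p_i^*$ strips $p$ down to a path starting with $e_{i+1}$, which $f^*$
  kills.

  Calculations take place on representatives in the free algebra, modulo the ideal of relations;
  cosets appear only where the stated definitions are unfolded.\<close>

lemma lookup_scale [simp]:
  "Poly_Mapping.lookup (scale c x) k = c * Poly_Mapping.lookup x k"
  unfolding scale_def by transfer (simp add: when_def)

lemma scale_single [simp]:
  "scale c (Poly_Mapping.single k d) = Poly_Mapping.single k (c * d)"
  by (simp add: scale_def)

lemma scale_zero_right [simp]: "scale c 0 = 0"
  by (rule poly_mapping_eqI) simp

lemma scale_zero_left [simp]: "scale 0 x = 0"
  by (rule poly_mapping_eqI) simp

lemma scale_one [simp]: "scale 1 x = x"
  by (rule poly_mapping_eqI) simp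

lemma scale_minus_one: "scale (-1) x = - x"
  by (rule poly_mapping_eqI) simp

lemma scale_scale: "scale c (scale d x) = scale (c * d) x"
  by (rule poly_mapping_eqI) simp

lemma scale_add_right: "scale c (x + y) = scale c x + scale c y"
  by (rule poly_mapping_eqI) (simp add: lookup_add algebra_simps)

lemma scale_diff_right: "scale c (x - y) = scale c x - scale c y"
  by (rule poly_mapping_eqI) (simp add: lookup_minus algebra_simps)

lemma scale_add_left: "scale (c + d) x = scale c x + scale d x"
  by (rule poly_mapping_eqI) (simp add: lookup_add algebra_simps)

lemma keys_scale: "Poly_Mapping.keys (scale c x) \<subseteq> Poly_Mapping.keys x"
  by (auto simp: in_keys_iff)

lemma scale_mult_left:
  fixes a :: "'m::monoid_add \<Rightarrow>\<^sub>0 'k::field"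
  shows "scale c a * b = scale c (a * b)"
  by (simp add: scale_def mult_map_scale_conv_mult mult.assoc)

lemma poly_mapping_sum_single:
  "x = (\<Sum>k\<in>Poly_Mapping.keys x. Poly_Mapping.single k (Poly_Mapping.lookup x k))"
proof (rule poly_mapping_eqI)
  fix k
  show "Poly_Mapping.lookup x k = Poly_Mapping.lookup
      (\<Sum>k\<in>Poly_Mapping.keys x. Poly_Mapping.single k (Poly_Mapping.lookup x k)) k"
    by (simp add: lookup_sum lookup_single when_def in_keys_iff)
qed

text \<open>Proves linear statements on basis elements. The single case keeps \<open>k\<close> in
  the support of the original \<open>x\<close>, so conditions on the support, such as membership in
  \<open>unital_alg\<close>, remain usable during the induction.\<close>

lemma poly_mapping_linear_induct [case_names zero single add]:
  fixes x :: "'a \<Rightarrow>\<^sub>0 'b::comm_monoid_add"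
  assumes "P 0"
    and "\<And>k c. k \<in> Poly_Mapping.keys x \<Longrightarrow> P (Poly_Mapping.single k c)"
    and "\<And>a b. P a \<Longrightarrow> P b \<Longrightarrow> P (a + b)"
  shows "P x"
proof -
  have "P (\<Sum>k\<in>A. Poly_Mapping.single k (Poly_Mapping.lookup x k))"
    if "finite A" "A \<subseteq> Poly_Mapping.keys x" for A
    using that by (induction A rule: finite_induct) (auto intro: assms)
  from this[OF finite_keys order_refl] show ?thesis
    using poly_mapping_sum_single[of x] by simp
qed

lemma scale_mult_right:
  fixes a :: "'m::monoid_add \<Rightarrow>\<^sub>0 'k::field"
  shows "a * scale c b = scale c (a * b)"
proof (induction a rule: poly_mapping_linear_induct)
  case (single k d)
  show ?case
    by (induction b rule: poly_mapping_linear_induct)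
       (auto simp: mult_single scale_add_right distrib_left mult_ac)
qed (auto simp: scale_add_right distrib_right)

lemma lin_ext_zero [simp]: "lin_ext f 0 = 0"
  by (simp add: lin_ext_def)

lemma lin_ext_single [simp]: "lin_ext f (Poly_Mapping.single k c) = scale c (f k)"
  by (simp add: lin_ext_def)

lemma lin_ext_add: "lin_ext f (x + y) = lin_ext f x + lin_ext f y"
  unfolding lin_ext_def by (rule setsum_keys_plus_distrib) (simp_all add: scale_add_left)

lemma lin_ext_scale: "lin_ext f (scale c x) = scale c (lin_ext f x)"
  by (induction x rule: poly_mapping_linear_induct)
     (simp_all add: lin_ext_add scale_add_right scale_scale)

lemma lin_ext_uminus: "lin_ext f (- x) = - lin_ext f x"
  using lin_ext_scale[of f "-1" x] by (simp add: scale_minus_one)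

lemma lin_ext_diff: "lin_ext f (x - y) = lin_ext f x - lin_ext f y"
  using lin_ext_add[of f x "- y"] by (simp add: lin_ext_uminus)

lemma lin_ext_sum: "lin_ext f (sum g A) = (\<Sum>i\<in>A. lin_ext f (g i))"
  by (induction A rule: infinite_finite_induct) (simp_all add: lin_ext_add)

lemma keys_lin_ext:
  assumes "\<And>k. k \<in> Poly_Mapping.keys x \<Longrightarrow> Poly_Mapping.keys (f k) \<subseteq> S"
  shows "Poly_Mapping.keys (lin_ext f x) \<subseteq> S"
proof (induction x rule: poly_mapping_linear_induct)
  case (single k c)
  then show ?case using keys_scale[of c "f k"] assms by auto
next
  case (add a b)
  then show ?case using keys_add[of "lin_ext f a" "lin_ext f b"] by (auto simp: lin_ext_add)
qed auto

section \<open>The action of the free algebra on streams\<close>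

lemma poly_act_zero [simp]: "poly_act E 0 x = 0"
  by (simp add: poly_act_def)

lemma poly_act_add: "poly_act E (a + b) x = poly_act E a x + poly_act E b x"
  by (simp add: poly_act_def lin_ext_add)

lemma poly_act_diff: "poly_act E (a - b) x = poly_act E a x - poly_act E b x"
  by (simp add: poly_act_def lin_ext_diff)

lemma poly_act_scale: "poly_act E (scale c a) x = scale c (poly_act E a x)"
  by (simp add: poly_act_def lin_ext_scale)

lemma poly_act_sum: "poly_act E (sum f A) x = (\<Sum>i\<in>A. poly_act E (f i) x)"
  by (simp add: poly_act_def lin_ext_sum)

lemma poly_act_single [simp]: "poly_act E (Poly_Mapping.single w c) x = scale c (word_act E w x)"
  by (simp add: poly_act_def)

lemma poly_act_monomial [simp]: "poly_act E (monomial gs) x = word_act E (Word gs) x"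
  by (simp add: monomial_def)

lemma word_act_zero_right: "word_act E w 0 = 0"
proof (cases w)
  case (Word gs)
  then show ?thesis by (induction gs arbitrary: w) simp_all
qed

lemma word_act_add_right: "word_act E w (x + y) = word_act E w x + word_act E w y"
proof (cases w)
  case (Word gs)
  then show ?thesis by (induction gs arbitrary: w) (simp_all add: lin_ext_add)
qed

lemma word_act_scale_right: "word_act E w (scale c x) = scale c (word_act E w x)"
proof (cases w)
  case (Word gs)
  then show ?thesis by (induction gs arbitrary: w) (simp_all add: lin_ext_scale)
qed

lemma word_act_plus: "word_act E (v + w) x = word_act E v (word_act E w x)"
  by (cases v; cases w) simp

lemma poly_act_zero_right [simp]: "poly_act E a 0 = 0"
  by (induction a rule: poly_mapping_linear_induct) (auto simp: poly_act_add word_act_zero_right)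

lemma poly_act_add_right: "poly_act E a (x + y) = poly_act E a x + poly_act E a y"
  by (induction a rule: poly_mapping_linear_induct)
     (auto simp: poly_act_add word_act_add_right scale_add_right algebra_simps)

lemma poly_act_scale_right: "poly_act E a (scale c x) = scale c (poly_act E a x)"
  by (induction a rule: poly_mapping_linear_induct)
     (auto simp: poly_act_add word_act_scale_right scale_add_right scale_scale mult_ac)

lemma poly_act_mult: "poly_act E (a * b) x = poly_act E a (poly_act E b x)"
proof (induction a rule: poly_mapping_linear_induct)
  case (single v c)
  show ?case
    by (induction b rule: poly_mapping_linear_induct)
       (auto simp: mult_single word_act_plus word_act_zero_right word_act_add_right
         word_act_scale_right scale_add_right scale_scale poly_act_add distrib_left)
qed (auto simp: distrib_right poly_act_add)

section \<open>Finite sums of sets\<close>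

text \<open>Counterpart of \<open>ideal_sum\<close> for representatives, with the type class sum in
  place of the sum of the algebra record.\<close>

definition set_sums :: "'i set \<Rightarrow> ('i \<Rightarrow> 'a::comm_monoid_add set) \<Rightarrow> 'a set" where
  "set_sums A G = {\<Sum>i\<in>B. g i |B g. finite B \<and> B \<subseteq> A \<and> (\<forall>i\<in>B. g i \<in> G i)}"

lemma set_sumsI: "finite B \<Longrightarrow> B \<subseteq> A \<Longrightarrow> (\<And>i. i \<in> B \<Longrightarrow> g i \<in> G i) \<Longrightarrow> sum g B \<in> set_sums A G"
  unfolding set_sums_def by blast

lemma set_sums_zero: "0 \<in> set_sums A G"
  using set_sumsI[of "{}" A] by simp

lemma set_sums_member: "i \<in> A \<Longrightarrow> x \<in> G i \<Longrightarrow> x \<in> set_sums A G"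
  using set_sumsI[of "{i}" A "\<lambda>_. x" G] by simp

lemma set_sums_subset:
  assumes "0 \<in> S" "\<And>x y. x \<in> S \<Longrightarrow> y \<in> S \<Longrightarrow> x + y \<in> S" "\<And>i. i \<in> A \<Longrightarrow> G i \<subseteq> S"
  shows "set_sums A G \<subseteq> S"
proof
  fix x assume "x \<in> set_sums A G"
  then obtain B g where B: "finite B" "B \<subseteq> A" "\<forall>i\<in>B. g i \<in> G i" and x: "x = sum g B"
    by (auto simp: set_sums_def)
  from B have "sum g B \<in> S"
    by (induction B rule: finite_induct) (use assms in auto)
  with x show "x \<in> S" by simp
qed

lemma set_sums_add:
  assumes G: "\<And>i. i \<in> A \<Longrightarrow> 0 \<in> G i" "\<And>i x y. i \<in> A \<Longrightarrow> x \<in> G i \<Longrightarrow> y \<in> G i \<Longrightarrow> x + y \<in> G i"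
    and x: "x \<in> set_sums A G" and y: "y \<in> set_sums A G"
  shows "x + y \<in> set_sums A G"
proof -
  obtain B g where B: "finite B" "B \<subseteq> A" "\<forall>i\<in>B. g i \<in> G i" and xB: "x = sum g B"
    using x by (auto simp: set_sums_def)
  obtain C h where C: "finite C" "C \<subseteq> A" "\<forall>i\<in>C. h i \<in> G i" and yC: "y = sum h C"
    using y by (auto simp: set_sums_def)
  \<comment> \<open>The two finite supports may differ, so both families are padded by zero to the
    union.\<close>
  define k where "k i = (if i \<in> B then g i else 0) + (if i \<in> C then h i else 0)" for i
  have "sum k (B \<union> C) \<in> set_sums A G"
    by (rule set_sumsI) (use B C G in \<open>auto simp: k_def subset_iff\<close>)
  moreover have "sum k (B \<union> C) = x + y"
    using B(1) C(1) unfolding k_def xB yC sum.distrib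
    by (simp add: sum.If_cases Int_absorb1 Un_Int_distrib2)
  ultimately show ?thesis by simp
qed

lemma set_sums_map:
  assumes "x \<in> set_sums A G" "f 0 = 0" "\<And>x y. f (x + y) = f x + f y"
    and "\<And>i x. i \<in> A \<Longrightarrow> x \<in> G i \<Longrightarrow> f x \<in> H i"
  shows "f x \<in> set_sums A H"
proof -
  obtain B g where B: "finite B" "B \<subseteq> A" "\<forall>i\<in>B. g i \<in> G i" and x: "x = sum g B"
    using assms(1) by (auto simp: set_sums_def)
  have "f (sum g B) = (\<Sum>i\<in>B. f (g i))"
    using B(1) by (induction B rule: finite_induct) (simp_all add: assms)
  then show ?thesis
    using B assms(4) by (auto simp: x intro!: set_sumsI)
qed

section \<open>The Leavitt path algebra as a quotient of the free algebra\<close>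

text \<open>The empty word is admitted because the algebra ideal is stable under multiplication by it
  too, so congruent words may be exchanged inside a longer word at any position.\<close>

definition unital_alg :: "('v, 'e) pre_digraph \<Rightarrow> ('v, 'e, 'k::field) lpa_poly set" where
  "unital_alg E = {x. Poly_Mapping.keys x \<subseteq> {Word gs |gs. set gs \<subseteq> lpa_gens E}}"

definition lpa_proj :: "('v, 'e) pre_digraph \<Rightarrow> ('v, 'e, 'k::field) lpa_poly \<Rightarrow> ('v, 'e, 'k) lpa_elem" where
  "lpa_proj E a = lpa_ideal E +>\<^bsub>free_alg E\<^esub> a"

text \<open>Equality in $L_K(E)$, expressed on representatives.\<close>

abbreviation lpa_cong :: "('v, 'e) pre_digraph \<Rightarrow> ('v, 'e, 'k::field) lpa_poly \<Rightarrow> ('v, 'e, 'k) lpa_poly \<Rightarrow> bool"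
  where "lpa_cong E a b \<equiv> a - b \<in> lpa_ideal E"

section \<open>Closure properties of the free algebra\<close>

lemma mem_free_alg:
  "x \<in> carrier (free_alg E) \<longleftrightarrow>
    (\<forall>w\<in>Poly_Mapping.keys x. \<exists>gs. w = Word gs \<and> gs \<noteq> [] \<and> set gs \<subseteq> lpa_gens E)"
  by (auto simp: free_alg_def)

lemma mem_unital_alg:
  "x \<in> unital_alg E \<longleftrightarrow> (\<forall>w\<in>Poly_Mapping.keys x. \<exists>gs. w = Word gs \<and> set gs \<subseteq> lpa_gens E)"
  by (auto simp: unital_alg_def)

lemma free_alg_subset_unital: "x \<in> carrier (free_alg E) \<Longrightarrow> x \<in> unital_alg E"
  unfolding mem_free_alg mem_unital_alg by blast

lemma free_alg_zero: "0 \<in> carrier (free_alg E)"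
  by (simp add: mem_free_alg)

lemma free_alg_add:
  "x \<in> carrier (free_alg E) \<Longrightarrow> y \<in> carrier (free_alg E) \<Longrightarrow> x + y \<in> carrier (free_alg E)"
  unfolding mem_free_alg using keys_add[of x y] by blast

lemma free_alg_scale: "x \<in> carrier (free_alg E) \<Longrightarrow> scale c x \<in> carrier (free_alg E)"
  unfolding mem_free_alg using keys_scale[of c x] by blast

lemma free_alg_uminus: "x \<in> carrier (free_alg E) \<Longrightarrow> - x \<in> carrier (free_alg E)"
  using free_alg_scale[of x E "-1"] by (simp add: scale_minus_one)

lemma free_alg_diff:
  "x \<in> carrier (free_alg E) \<Longrightarrow> y \<in> carrier (free_alg E) \<Longrightarrow> x - y \<in> carrier (free_alg E)"
  using free_alg_add[of x E "- y"] by (simp add: free_alg_uminus)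

lemma free_alg_sum:
  "(\<And>i. i \<in> A \<Longrightarrow> f i \<in> carrier (free_alg E)) \<Longrightarrow> sum f A \<in> carrier (free_alg E)"
  by (induction A rule: infinite_finite_induct) (auto simp: free_alg_zero free_alg_add)

lemma free_alg_monomial:
  "gs \<noteq> [] \<Longrightarrow> set gs \<subseteq> lpa_gens E \<Longrightarrow> monomial gs \<in> carrier (free_alg E)"
  by (simp add: mem_free_alg monomial_def)

lemma free_alg_mult_left:
  assumes "x \<in> unital_alg E" "y \<in> carrier (free_alg E)"
  shows "x * y \<in> carrier (free_alg E)"
  unfolding mem_free_alg
proof
  fix w assume "w \<in> Poly_Mapping.keys (x * y)"
  then obtain a b where w: "w = a + b" "a \<in> Poly_Mapping.keys x" "b \<in> Poly_Mapping.keys y"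
    using keys_mult[of x y] by blast
  obtain gs hs where "a = Word gs" "set gs \<subseteq> lpa_gens E" "b = Word hs" "hs \<noteq> []" "set hs \<subseteq> lpa_gens E"
    using assms w(2,3) unfolding mem_free_alg mem_unital_alg by blast
  then show "\<exists>gs. w = Word gs \<and> gs \<noteq> [] \<and> set gs \<subseteq> lpa_gens E"
    by (simp add: w(1))
qed

lemma free_alg_mult:
  "x \<in> carrier (free_alg E) \<Longrightarrow> y \<in> carrier (free_alg E) \<Longrightarrow> x * y \<in> carrier (free_alg E)"
  by (simp add: free_alg_mult_left free_alg_subset_unital)

lemma unital_alg_monomial: "set gs \<subseteq> lpa_gens E \<Longrightarrow> monomial gs \<in> unital_alg E"
  by (simp add: mem_unital_alg monomial_def)

lemma monomial_Nil: "monomial [] = 1"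
  by (simp add: monomial_def flip: zero_free_word_def)

lemma monomial_mult: "monomial gs * monomial hs = monomial (gs @ hs)"
  by (simp add: monomial_def mult_single)

lemma single_eq_scale_monomial: "Poly_Mapping.single (Word gs) c = scale c (monomial gs)"
  by (simp add: monomial_def)

section \<open>The ideal of relations and congruence modulo it\<close>

lemma lpa_ideal_uminus: "x \<in> lpa_ideal E \<Longrightarrow> - x \<in> lpa_ideal E"
  using lpa_ideal.scale[of x E "-1"] by (simp add: scale_minus_one)

lemma lpa_ideal_diff: "x \<in> lpa_ideal E \<Longrightarrow> y \<in> lpa_ideal E \<Longrightarrow> x - y \<in> lpa_ideal E"
  using lpa_ideal.add[of x E "- y"] by (simp add: lpa_ideal_uminus)

lemma lpa_ideal_sum: "(\<And>i. i \<in> A \<Longrightarrow> f i \<in> lpa_ideal E) \<Longrightarrow> sum f A \<in> lpa_ideal E"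
  by (induction A rule: infinite_finite_induct) (auto intro: lpa_ideal.zero lpa_ideal.add)

lemma lpa_ideal_mult_left:
  assumes "x \<in> lpa_ideal E" "a \<in> unital_alg E"
  shows "a * x \<in> lpa_ideal E"
proof (induction a rule: poly_mapping_linear_induct)
  case (single w c)
  then obtain gs where w: "w = Word gs" "set gs \<subseteq> lpa_gens E"
    using assms(2) by (auto simp: mem_unital_alg)
  have "monomial gs * x \<in> lpa_ideal E"
    using w(2) assms(1) by (cases "gs = []")
      (auto simp: monomial_Nil intro: lpa_ideal.left_mult free_alg_monomial)
  then show ?case
    by (simp add: w(1) single_eq_scale_monomial scale_mult_left lpa_ideal.scale)
qed (auto simp: distrib_right intro: lpa_ideal.zero lpa_ideal.add)

lemma lpa_ideal_mult_right:
  assumes "x \<in> lpa_ideal E" "a \<in> unital_alg E"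
  shows "x * a \<in> lpa_ideal E"
proof (induction a rule: poly_mapping_linear_induct)
  case (single w c)
  then obtain gs where w: "w = Word gs" "set gs \<subseteq> lpa_gens E"
    using assms(2) by (auto simp: mem_unital_alg)
  have "x * monomial gs \<in> lpa_ideal E"
    using w(2) assms(1) by (cases "gs = []")
      (auto simp: monomial_Nil intro: lpa_ideal.right_mult free_alg_monomial)
  then show ?case
    by (simp add: w(1) single_eq_scale_monomial scale_mult_right lpa_ideal.scale)
qed (auto simp: distrib_left intro: lpa_ideal.zero lpa_ideal.add)

lemma lpa_cong_refl: "lpa_cong E a a"
  by (simp add: lpa_ideal.zero)

lemma lpa_cong_sym: "lpa_cong E a b \<Longrightarrow> lpa_cong E b a"
  using lpa_ideal_uminus[of "a - b" E] by simp

lemma lpa_cong_trans [trans]: "lpa_cong E a b \<Longrightarrow> lpa_cong E b c \<Longrightarrow> lpa_cong E a c"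
  using lpa_ideal.add[of "a - b" E "b - c"] by simp

lemma lpa_cong_add: "lpa_cong E a b \<Longrightarrow> lpa_cong E c d \<Longrightarrow> lpa_cong E (a + c) (b + d)"
  using lpa_ideal.add[of "a - b" E "c - d"] by (simp add: algebra_simps)

lemma lpa_cong_scale: "lpa_cong E a b \<Longrightarrow> lpa_cong E (scale c a) (scale c b)"
  using lpa_ideal.scale[of "a - b" E c] by (simp add: scale_diff_right)

lemma lpa_cong_ideal: "lpa_cong E a b \<Longrightarrow> a \<in> lpa_ideal E \<longleftrightarrow> b \<in> lpa_ideal E"
  using lpa_ideal.add[of "a - b" E b] lpa_ideal_diff[of a E "a - b"] by auto

lemma lpa_cong_mult_left: "lpa_cong E a b \<Longrightarrow> c \<in> unital_alg E \<Longrightarrow> lpa_cong E (c * a) (c * b)"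
  using lpa_ideal_mult_left[of "a - b" E c] by (simp add: right_diff_distrib)

lemma lpa_cong_mult_right: "lpa_cong E a b \<Longrightarrow> c \<in> unital_alg E \<Longrightarrow> lpa_cong E (a * c) (b * c)"
  using lpa_ideal_mult_right[of "a - b" E c] by (simp add: left_diff_distrib)

lemma lpa_cong_context:
  assumes "lpa_cong E a b" "set us \<subseteq> lpa_gens E" "set vs \<subseteq> lpa_gens E"
  shows "lpa_cong E (monomial us * a * monomial vs) (monomial us * b * monomial vs)"
  by (intro lpa_cong_mult_right lpa_cong_mult_left unital_alg_monomial assms)

context wf_digraph
begin

lemma lpa_gens_simps [simp]:
  "Vert v \<in> lpa_gens G \<longleftrightarrow> v \<in> verts G"
  "Edge e \<in> lpa_gens G \<longleftrightarrow> e \<in> arcs G"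
  "Ghost e \<in> lpa_gens G \<longleftrightarrow> e \<in> arcs G"
  by (auto simp: lpa_gens_def)

lemma lpa_relations_subset: "x \<in> lpa_relations G \<Longrightarrow> x \<in> carrier (free_alg G)"
proof (induction rule: lpa_relations.induct)
  case (CK2 v)
  then show ?case
    by (intro free_alg_diff free_alg_sum free_alg_monomial) auto
qed (auto intro!: free_alg_diff free_alg_monomial free_alg_zero)

lemma lpa_ideal_subset: "x \<in> lpa_ideal G \<Longrightarrow> x \<in> carrier (free_alg G)"
  by (induction rule: lpa_ideal.induct)
    (auto intro: lpa_relations_subset free_alg_zero free_alg_add free_alg_scale free_alg_mult)

section \<open>The operations of the quotient computed on representatives\<close>

lemma mem_lpa_proj: "x \<in> lpa_proj G a \<longleftrightarrow> lpa_cong G x a"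
proof -
  have "x \<in> lpa_proj G a \<longleftrightarrow> (\<exists>h\<in>lpa_ideal G. x = h + a)"
    by (auto simp: lpa_proj_def a_r_coset_def r_coset_def free_alg_def)
  also have "\<dots> \<longleftrightarrow> lpa_cong G x a"
    by (metis add_diff_cancel diff_add_cancel)
  finally show ?thesis .
qed

lemma lpa_proj_eq_iff: "lpa_proj G a = lpa_proj G b \<longleftrightarrow> lpa_cong G a b"
  by (auto simp: set_eq_iff mem_lpa_proj intro: lpa_cong_trans lpa_cong_sym lpa_cong_refl)

lemma lpa_carrier: "carrier (lpa G) = lpa_proj G ` carrier (free_alg G)"
  by (auto simp: lpa_def A_RCOSETS_def RCOSETS_def lpa_proj_def a_r_coset_def)

lemma lpa_zero: "\<zero>\<^bsub>lpa G\<^esub> = lpa_proj G 0"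
  by (auto simp: set_eq_iff mem_lpa_proj) (simp_all add: lpa_def)

lemma lpa_word_eq: "lpa_word G gs = lpa_proj G (monomial gs)"
  by (simp add: lpa_word_def lpa_proj_def)

lemma lpa_add: "lpa_proj G a \<oplus>\<^bsub>lpa G\<^esub> lpa_proj G b = lpa_proj G (a + b)"
proof -
  have "x \<in> lpa_proj G a \<oplus>\<^bsub>lpa G\<^esub> lpa_proj G b \<longleftrightarrow>
      (\<exists>y\<in>lpa_proj G a. \<exists>z\<in>lpa_proj G b. x = y + z)" for x
    by (auto simp: lpa_def set_add_def set_mult_def free_alg_def)
  moreover have "(\<exists>y\<in>lpa_proj G a. \<exists>z\<in>lpa_proj G b. x = y + z) \<longleftrightarrow> x \<in> lpa_proj G (a + b)" for x
  proof
    assume "x \<in> lpa_proj G (a + b)"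
    then have "x - b \<in> lpa_proj G a" "b \<in> lpa_proj G b"
      by (auto simp: mem_lpa_proj lpa_ideal.zero algebra_simps)
    then show "\<exists>y\<in>lpa_proj G a. \<exists>z\<in>lpa_proj G b. x = y + z"
      by (metis diff_add_cancel)
  qed (auto simp: mem_lpa_proj intro: lpa_cong_add)
  ultimately show ?thesis by blast
qed

text \<open>The ideal absorbs factors from the free algebra only, hence the carrier assumptions. Any
  other representative of the coset of \<open>b\<close> differs from \<open>b\<close> by an ideal
  element and so stays in the free algebra; the factors can then be exchanged one at a time.\<close>

lemma lpa_mult:
  assumes "a \<in> carrier (free_alg G)" "b \<in> carrier (free_alg G)"
  shows "lpa_proj G a \<otimes>\<^bsub>lpa G\<^esub> lpa_proj G b = lpa_proj G (a * b)"
proof -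
  have "lpa_proj G (x * y) = lpa_proj G (a * b)"
    if "x \<in> lpa_proj G a" "y \<in> lpa_proj G b" for x y
  proof -
    have "y \<in> carrier (free_alg G)"
      using free_alg_add[OF lpa_ideal_subset assms(2)] that(2) by (auto simp: mem_lpa_proj) (metis diff_add_cancel)
    then have "lpa_cong G (x * y) (a * y)"
      using that by (intro lpa_cong_mult_right free_alg_subset_unital) (auto simp: mem_lpa_proj)
    also have "lpa_cong G (a * y) (a * b)"
      using that assms by (intro lpa_cong_mult_left free_alg_subset_unital) (auto simp: mem_lpa_proj)
    finally show ?thesis by (simp add: lpa_proj_eq_iff)
  qed
  moreover have "a \<in> lpa_proj G a" "b \<in> lpa_proj G b"
    by (simp_all add: mem_lpa_proj lpa_ideal.zero)
  ultimately have "(\<Union>x\<in>lpa_proj G a. \<Union>y\<in>lpa_proj G b. lpa_proj G (x * y)) = lpa_proj G (a * b)"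
    by blast
  then show ?thesis
    by (simp add: lpa_def rcoset_mult_def free_alg_def lpa_proj_def)
qed

lemma lpa_smult: "c \<odot>\<^bsub>lpa G\<^esub> lpa_proj G a = lpa_proj G (scale c a)"
proof -
  have "lpa_proj G (scale c x) = lpa_proj G (scale c a)" if "x \<in> lpa_proj G a" for x
    using that by (simp add: lpa_proj_eq_iff mem_lpa_proj lpa_cong_scale)
  moreover have "a \<in> lpa_proj G a"
    by (simp add: mem_lpa_proj lpa_ideal.zero)
  ultimately have "(\<Union>x\<in>lpa_proj G a. lpa_proj G (scale c x)) = lpa_proj G (scale c a)"
    by blast
  then show ?thesis
    by (simp add: lpa_def lpa_proj_def)
qed

lemma abelian_group_lpa: "abelian_group (lpa G)"
proof (rule abelian_groupI)
  fix x assume "x \<in> carrier (lpa G)"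
  then obtain a where a: "a \<in> carrier (free_alg G)" "x = lpa_proj G a"
    by (auto simp: lpa_carrier)
  have "lpa_proj G (- a) \<oplus>\<^bsub>lpa G\<^esub> x = \<zero>\<^bsub>lpa G\<^esub>"
    by (simp add: lpa_add lpa_zero a)
  then show "\<exists>y\<in>carrier (lpa G). y \<oplus>\<^bsub>lpa G\<^esub> x = \<zero>\<^bsub>lpa G\<^esub>"
    using a by (auto simp: lpa_carrier intro: free_alg_uminus)
qed (auto simp: lpa_carrier lpa_add lpa_zero add_ac intro!: imageI free_alg_add free_alg_zero)

lemma lpa_finsum:
  assumes "\<And>i. i \<in> B \<Longrightarrow> f i \<in> carrier (free_alg G)" "finite B"
  shows "(\<Oplus>\<^bsub>lpa G\<^esub>i\<in>B. lpa_proj G (f i)) = lpa_proj G (sum f B)"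
proof -
  interpret abelian_group "lpa G" by (rule abelian_group_lpa)
  show ?thesis
    using assms(2,1)
  proof (induction B rule: finite_induct)
    case empty
    then show ?case by (simp add: lpa_zero)
  next
    case (insert i B)
    then have "(\<lambda>i. lpa_proj G (f i)) \<in> insert i B \<rightarrow> carrier (lpa G)"
      by (auto simp: lpa_carrier)
    with insert show ?case by (simp add: finsum_insert lpa_add Pi_def)
  qed
qed

text \<open>Representatives of finitely many summands can be chosen simultaneously. It serves twice:
  for the sum over $f$ inside one $J_i(p)$ and for the sum over $i$.\<close>

lemma ideal_sum_lpa_proj:
  assumes J: "\<And>i. i \<in> A \<Longrightarrow> J i = lpa_proj G ` S i"
    and S: "\<And>i. i \<in> A \<Longrightarrow> S i \<subseteq> carrier (free_alg G)"
  shows "ideal_sum (lpa G) A J = lpa_proj G ` set_sums A S"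
proof (intro equalityI subsetI)
  interpret abelian_group "lpa G" by (rule abelian_group_lpa)
  fix x assume "x \<in> ideal_sum (lpa G) A J"
  then obtain B g where B: "finite B" "B \<subseteq> A" "\<forall>i\<in>B. g i \<in> J i" and x: "x = (\<Oplus>\<^bsub>lpa G\<^esub>i\<in>B. g i)"
    unfolding ideal_sum_def by blast
  from B(2,3) have "\<forall>i\<in>B. \<exists>a. a \<in> S i \<and> g i = lpa_proj G a"
    by (metis J imageE subsetD)
  then obtain h where h: "\<And>i. i \<in> B \<Longrightarrow> h i \<in> S i \<and> g i = lpa_proj G (h i)"
    by metis
  have hF: "h i \<in> carrier (free_alg G)" if "i \<in> B" for i
    using h[OF that] S B(2) that by blast
  have "x = (\<Oplus>\<^bsub>lpa G\<^esub>i\<in>B. lpa_proj G (h i))"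
    unfolding x by (rule finsum_cong') (use h hF in \<open>auto simp: lpa_carrier\<close>)
  also have "\<dots> = lpa_proj G (sum h B)"
    by (rule lpa_finsum[OF hF B(1)])
  finally show "x \<in> lpa_proj G ` set_sums A S"
    using B h by (auto intro!: set_sumsI)
next
  fix x assume "x \<in> lpa_proj G ` set_sums A S"
  then obtain B g where B: "finite B" "B \<subseteq> A" "\<forall>i\<in>B. g i \<in> S i" and x: "x = lpa_proj G (sum g B)"
    unfolding set_sums_def by blast
  have "x = (\<Oplus>\<^bsub>lpa G\<^esub>i\<in>B. lpa_proj G (g i))"
    unfolding x by (rule lpa_finsum[symmetric]) (use B S in auto)
  then show "x \<in> ideal_sum (lpa G) A J"
    using B J unfolding ideal_sum_def by blast
qed

lemma PIdl_lpa_proj: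
  assumes "b \<in> carrier (free_alg G)"
  shows "PIdl\<^bsub>lpa G\<^esub> (lpa_proj G b) = lpa_proj G ` {r * b |r. r \<in> carrier (free_alg G)}"
  unfolding cgenideal_def lpa_carrier using assms by (auto simp: lpa_mult image_def) (metis lpa_mult)+

text \<open>Closure under scaling by $-1$ supplies the additive inverses. \<open>S\<close> need not
  contain the ideal of relations, so sums of explicit multiples can be used as they are.\<close>

lemma left_ideal_lpa_proj:
  assumes S: "S \<subseteq> carrier (free_alg G)" "0 \<in> S" "\<And>x y. x \<in> S \<Longrightarrow> y \<in> S \<Longrightarrow> x + y \<in> S"
    and scale: "\<And>c x. x \<in> S \<Longrightarrow> scale c x \<in> S"
    and mult: "\<And>r x. r \<in> carrier (free_alg G) \<Longrightarrow> x \<in> S \<Longrightarrow> r * x \<in> S"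
  shows "left_ideal (lpa G) (lpa_proj G ` S)"
  unfolding left_ideal_def
proof (intro conjI allI ballI)
  interpret abelian_group "lpa G" by (rule abelian_group_lpa)
  have inv: "\<ominus>\<^bsub>lpa G\<^esub> lpa_proj G x = lpa_proj G (scale (-1) x)" if "x \<in> S" for x
    using that S(1) by (intro minus_equality)
      (auto simp: lpa_carrier lpa_add lpa_zero scale_minus_one free_alg_uminus)
  have "subgroup (lpa_proj G ` S) (add_monoid (lpa G))"
  proof (rule group.subgroupI)
    show "group (add_monoid (lpa G))" by (rule a_group)
    show "inv\<^bsub>add_monoid (lpa G)\<^esub> x \<in> lpa_proj G ` S" if "x \<in> lpa_proj G ` S" for x
      using that inv scale by (auto simp: a_inv_def)
  qed (use S in \<open>auto simp: lpa_carrier lpa_add\<close>)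
  then show "additive_subgroup (lpa_proj G ` S) (lpa G)"
    by (rule additive_subgroup.intro)
  show "c \<odot>\<^bsub>lpa G\<^esub> x \<in> lpa_proj G ` S" if "x \<in> lpa_proj G ` S" for c x
    using that scale by (auto simp: lpa_smult)
  show "r \<otimes>\<^bsub>lpa G\<^esub> x \<in> lpa_proj G ` S" if rx: "r \<in> carrier (lpa G)" "x \<in> lpa_proj G ` S" for r x
  proof -
    obtain a b where "a \<in> carrier (free_alg G)" "r = lpa_proj G a" "b \<in> S" "x = lpa_proj G b"
      using rx unfolding lpa_carrier by blast
    then show ?thesis using subsetD[OF S(1)] by (auto simp: lpa_mult intro: mult)
  qed
qed

section \<open>The action on infinite paths\<close>

lemma infinite_path_SCons_iff:
  "infinite_path G (e ## q) \<longleftrightarrow> e \<in> arcs G \<and> head G e = path_source G q \<and> infinite_path G q"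
  (is "?l \<longleftrightarrow> ?r")
proof
  assume l: ?l
  have "q !! i \<in> arcs G \<and> head G (q !! i) = tail G (q !! Suc i)" for i
    using l[unfolded infinite_path_def, rule_format, of "Suc i"] by simp
  moreover have "e \<in> arcs G \<and> head G e = tail G (shd q)"
    using l[unfolded infinite_path_def, rule_format, of 0] by simp
  ultimately show ?r by (simp add: infinite_path_def path_source_def)
next
  assume r: ?r
  show ?l unfolding infinite_path_def
  proof
    fix i
    show "(e ## q) !! i \<in> arcs G \<and> head G ((e ## q) !! i) = tail G ((e ## q) !! Suc i)"
      using r by (cases i) (auto simp: infinite_path_def path_source_def)
  qed
qed

lemma infinite_path_stl: "infinite_path G q \<Longrightarrow> infinite_path G (stl q)"
  by (cases q) (simp add: infinite_path_SCons_iff)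

lemma infinite_path_shd:
  "infinite_path G q \<Longrightarrow> shd q \<in> arcs G"
  "infinite_path G q \<Longrightarrow> head G (shd q) = path_source G (stl q)"
  by (cases q; simp add: infinite_path_SCons_iff)+

lemma infinite_path_sdrop: "infinite_path G q \<Longrightarrow> infinite_path G (sdrop k q)"
  by (induction k arbitrary: q) (auto intro: infinite_path_stl)

lemma infinite_path_snth: "infinite_path G q \<Longrightarrow> q !! i \<in> arcs G"
  by (simp add: infinite_path_def)

lemma path_source_simps [simp]: "path_source G (e ## q) = tail G e"
  by (simp add: path_source_def)

lemma infinite_path_awalk:
  "infinite_path G q \<Longrightarrow> awalk (path_source G q) (stake k q) (path_source G (sdrop k q))"
proof (induction k arbitrary: q)
  case 0
  then show ?case using infinite_path_shd(1)[of q] by (simp add: awalk_Nil_iff path_source_def)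
next
  case (Suc k)
  then show ?case
    using infinite_path_shd[of q] infinite_path_stl[of q]
    by (simp add: awalk_Cons_iff) (simp add: path_source_def)
qed

lemma set_stake_arcs: "infinite_path G q \<Longrightarrow> set (stake k q) \<subseteq> arcs G"
  using infinite_path_awalk[of q k] by (simp add: awalk_def)

lemma gen_act_keys:
  assumes "infinite_path G q" "g \<in> lpa_gens G"
  shows "Poly_Mapping.keys (gen_act G g q :: _ \<Rightarrow>\<^sub>0 'k::field) \<subseteq> Collect (infinite_path G)"
  using assms by (cases g) (auto simp: infinite_path_SCons_iff infinite_path_stl)

lemma word_act_keys:
  fixes x :: "'b stream \<Rightarrow>\<^sub>0 'k::field"
  assumes "set gs \<subseteq> lpa_gens G" "Poly_Mapping.keys x \<subseteq> Collect (infinite_path G)"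
  shows "Poly_Mapping.keys (word_act G (Word gs) x) \<subseteq> Collect (infinite_path G)"
  using assms(1)
proof (induction gs)
  case (Cons g gs)
  then have "Poly_Mapping.keys (lin_ext (gen_act G g) (word_act G (Word gs) x)) \<subseteq> Collect (infinite_path G)"
    by (intro keys_lin_ext gen_act_keys) auto
  then show ?case by simp
qed (use assms(2) in simp)

lemma poly_act_keys:
  fixes x :: "'b stream \<Rightarrow>\<^sub>0 'k::field"
  assumes "a \<in> unital_alg G" "Poly_Mapping.keys x \<subseteq> Collect (infinite_path G)"
  shows "Poly_Mapping.keys (poly_act G a x) \<subseteq> Collect (infinite_path G)"
  unfolding poly_act_def
proof (rule keys_lin_ext)
  fix w assume "w \<in> Poly_Mapping.keys a"
  then obtain gs where "w = Word gs" "set gs \<subseteq> lpa_gens G"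
    using assms(1) by (auto simp: mem_unital_alg)
  then show "Poly_Mapping.keys (word_act G w x) \<subseteq> Collect (infinite_path G)"
    using word_act_keys[OF _ assms(2)] by simp
qed

lemma lpa_relations_act_path:
  assumes "r \<in> lpa_relations G" "infinite_path G q"
  shows "poly_act G r (Poly_Mapping.single q (1::'k::field)) = 0"
  using assms(1)
proof cases
  case (CK2 v)
  \<comment> \<open>Only the first edge of \<open>q\<close> survives $e e^*$, so the (CK2) sum
    collapses to one term, present exactly when \<open>q\<close> starts at \<open>v\<close>.\<close>
  have *: "word_act G (Word [Edge e, Ghost e]) (Poly_Mapping.single q (1::'k)) =
      (if e = shd q then Poly_Mapping.single q 1 else 0)" for e
    using infinite_path_shd[OF assms(2)] by auto
  have "(\<Sum>e\<in>out_arcs G v. word_act G (Word [Edge e, Ghost e]) (Poly_Mapping.single q (1::'k))) =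
      (if shd q \<in> out_arcs G v then Poly_Mapping.single q 1 else 0)"
    unfolding * using CK2(4) by simp
  also have "shd q \<in> out_arcs G v \<longleftrightarrow> v = path_source G q"
    using infinite_path_shd(1)[OF assms(2)] by (auto simp: path_source_def)
  finally show ?thesis
    unfolding CK2 by (simp add: poly_act_diff poly_act_sum del: word_act.simps) simp
qed (use assms(2) infinite_path_shd[OF assms(2)] in \<open>auto simp: poly_act_diff path_source_def\<close>)

lemma lpa_relations_act:
  fixes y :: "'b stream \<Rightarrow>\<^sub>0 'k::field"
  assumes "r \<in> lpa_relations G" "Poly_Mapping.keys y \<subseteq> Collect (infinite_path G)"
  shows "poly_act G r y = 0"
proof (induction y rule: poly_mapping_linear_induct)
  case (single q c)
  then have "poly_act G r (scale c (Poly_Mapping.single q 1)) = 0"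
    using assms lpa_relations_act_path[of r q] unfolding poly_act_scale_right by auto
  then show ?case by simp
qed (auto simp: poly_act_add_right)

text \<open>This makes the action of cosets well defined. Genuine infinite paths are required, since
  on a stream whose edges do not match the relations can fail. The vector \<open>y\<close> is
  generalised because in the \<open>right_mult\<close> case the relation acts on the image of
  \<open>y\<close> under \<open>a\<close>.\<close>

lemma lpa_ideal_act:
  fixes y :: "'b stream \<Rightarrow>\<^sub>0 'k::field"
  assumes "x \<in> lpa_ideal G" "Poly_Mapping.keys y \<subseteq> Collect (infinite_path G)"
  shows "poly_act G x y = 0"
  using assms
proof (induction arbitrary: y rule: lpa_ideal.induct)
  case (right_mult x a)
  then show ?case by (simp add: poly_act_mult poly_act_keys free_alg_subset_unital)
qed (auto simp: lpa_relations_act poly_act_add poly_act_scale poly_act_mult)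

lemma lpa_cong_act:
  fixes y :: "'b stream \<Rightarrow>\<^sub>0 'k::field"
  assumes "lpa_cong G a b" "Poly_Mapping.keys y \<subseteq> Collect (infinite_path G)"
  shows "poly_act G a y = poly_act G b y"
  using lpa_ideal_act[OF assms] by (simp add: poly_act_diff)

lemma rho_lpa_proj:
  fixes a :: "('a, 'b, 'k::field) lpa_poly"
  assumes "infinite_path G p"
  shows "rho G p (lpa_proj G a) = poly_act G a (Poly_Mapping.single p 1)"
proof -
  have "a \<in> lpa_proj G a" by (simp add: mem_lpa_proj lpa_ideal.zero)
  moreover have "poly_act G b (Poly_Mapping.single p (1::'k)) = poly_act G a (Poly_Mapping.single p 1)"
    if "b \<in> lpa_proj G a" for b
    by (rule lpa_cong_act) (use that assms in \<open>auto simp: mem_lpa_proj\<close>)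
  \<comment> \<open>The image is a singleton, so \<open>the_elem\<close> in the definition of the
    Chen module returns the intended value.\<close>
  ultimately have "(\<lambda>b. poly_act G b (Poly_Mapping.single p 1)) ` lpa_proj G a =
      {poly_act G a (Poly_Mapping.single p (1::'k))}"
    by blast
  then show ?thesis by (simp add: rho_def chen_module_def)
qed

section \<open>Paths and ghost paths in the Leavitt path algebra\<close>

lemma monomial_rel:
  assumes "lpa_cong G (monomial xs :: ('a, 'b, 'k::field) lpa_poly) (monomial ys)"
    and "set us \<subseteq> lpa_gens G" "set vs \<subseteq> lpa_gens G"
  shows "lpa_cong G (monomial (us @ xs @ vs) :: ('a, 'b, 'k) lpa_poly) (monomial (us @ ys @ vs))"
  using lpa_cong_context[OF assms] by (simp add: monomial_mult)

lemma monomial_rel_zero: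
  assumes "(monomial xs :: ('a, 'b, 'k::field) lpa_poly) \<in> lpa_ideal G"
    and "set us \<subseteq> lpa_gens G" "set vs \<subseteq> lpa_gens G"
  shows "(monomial (us @ xs @ vs) :: ('a, 'b, 'k) lpa_poly) \<in> lpa_ideal G"
  using lpa_cong_context[of "monomial xs :: ('a, 'b, 'k) lpa_poly" 0 G us vs] assms by (simp add: monomial_mult)

lemma
  assumes "e \<in> arcs G"
  shows cong_tail_Edge: "lpa_cong G (monomial [Vert (tail G e), Edge e]) (monomial [Edge e])"
    and cong_Edge_head: "lpa_cong G (monomial [Edge e, Vert (head G e)]) (monomial [Edge e])"
    and cong_head_Ghost: "lpa_cong G (monomial [Vert (head G e), Ghost e]) (monomial [Ghost e])"
    and cong_Ghost_tail: "lpa_cong G (monomial [Ghost e, Vert (tail G e)]) (monomial [Ghost e])"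
    and cong_Ghost_Edge: "lpa_cong G (monomial [Ghost e, Edge e]) (monomial [Vert (head G e)])"
  using assms lpa_relations.intros(2-5)[of e G] lpa_relations.CK1[of e G e]
  by (auto intro: lpa_ideal.relation)

lemma Ghost_Edge_ideal:
  "e \<in> arcs G \<Longrightarrow> e' \<in> arcs G \<Longrightarrow> e \<noteq> e' \<Longrightarrow> monomial [Ghost e, Edge e'] \<in> lpa_ideal G"
  using lpa_relations.CK1[of e G e'] by (auto intro: lpa_ideal.relation)

lemma Vert_Vert_ideal:
  "u \<in> verts G \<Longrightarrow> v \<in> verts G \<Longrightarrow> u \<noteq> v \<Longrightarrow> monomial [Vert u, Vert v] \<in> lpa_ideal G"
  using lpa_relations.V[of u G v] by (auto intro: lpa_ideal.relation)

text \<open>Insert the source of $e$: $u e = u s(e) e$, which vanishes by (V).\<close>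

lemma Vert_Edge_ideal:
  assumes "u \<in> verts G" "e \<in> arcs G" "u \<noteq> tail G e"
  shows "monomial [Vert u, Edge e] \<in> lpa_ideal G"
proof -
  have "monomial ([] @ [Vert u, Vert (tail G e)] @ [Edge e]) \<in> lpa_ideal G"
    by (rule monomial_rel_zero) (use assms in \<open>auto intro: Vert_Vert_ideal\<close>)
  moreover have "lpa_cong G (monomial ([Vert u] @ [Vert (tail G e), Edge e] @ []))
      (monomial ([Vert u] @ [Edge e] @ []))"
    by (rule monomial_rel) (use assms in \<open>auto intro: cong_tail_Edge\<close>)
  ultimately show ?thesis using lpa_cong_ideal by fastforce
qed

text \<open>Insert the range of $e$: $e e' = e r(e) e'$, which vanishes by the preceding
  lemma.\<close>

lemma Edge_Edge_ideal:
  assumes "e \<in> arcs G" "e' \<in> arcs G" "head G e \<noteq> tail G e'"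
  shows "monomial [Edge e, Edge e'] \<in> lpa_ideal G"
proof -
  have "monomial ([Edge e] @ [Vert (head G e), Edge e'] @ []) \<in> lpa_ideal G"
    by (rule monomial_rel_zero) (use assms in \<open>auto intro: Vert_Edge_ideal\<close>)
  moreover have "lpa_cong G (monomial ([] @ [Edge e, Vert (head G e)] @ [Edge e']))
      (monomial ([] @ [Edge e] @ [Edge e']))"
    by (rule monomial_rel) (use assms in \<open>auto intro: cong_Edge_head\<close>)
  ultimately show ?thesis using lpa_cong_ideal by fastforce
qed

text \<open>Unlike \<open>star_word\<close>, these two abbreviations yield the empty word, not a
  vertex, on the empty path; this is the source of the nonemptiness hypotheses below.\<close>

abbreviation edge_word :: "'b list \<Rightarrow> ('a, 'b) lpa_gen list" where
  "edge_word es \<equiv> map Edge es"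

abbreviation ghost_word :: "'b list \<Rightarrow> ('a, 'b) lpa_gen list" where
  "ghost_word es \<equiv> rev (map Ghost es)"

lemma set_edge_word: "set es \<subseteq> arcs G \<Longrightarrow> set (edge_word es) \<subseteq> lpa_gens G"
  and set_ghost_word: "set es \<subseteq> arcs G \<Longrightarrow> set (ghost_word es) \<subseteq> lpa_gens G"
  by auto

lemma awalk_arcs: "awalk u es v \<Longrightarrow> set es \<subseteq> arcs G"
  by (simp add: awalk_def)

lemma ghost_word_Vert:
  assumes "awalk u es v" "es \<noteq> []"
  shows "lpa_cong G (monomial (ghost_word es @ [Vert u])) (monomial (ghost_word es))"
proof -
  obtain e es' where es: "es = e # es'" using assms(2) by (cases es) auto
  have "lpa_cong G (monomial (ghost_word es' @ [Ghost e, Vert (tail G e)] @ []))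
     (monomial (ghost_word es' @ [Ghost e] @ []))"
    by (rule monomial_rel[OF cong_Ghost_tail]) (use awalk_arcs[OF assms(1)] in \<open>auto simp: es\<close>)
  then show ?thesis using assms(1) by (auto simp: es awalk_simps)
qed

lemma Vert_ghost_word:
  assumes "awalk u es v" "es \<noteq> []"
  shows "lpa_cong G (monomial (Vert v # ghost_word es)) (monomial (ghost_word es))"
proof -
  obtain es' e where es: "es = es' @ [e]" using assms(2) by (cases es rule: rev_cases) auto
  have "lpa_cong G (monomial ([] @ [Vert (head G e), Ghost e] @ ghost_word es'))
     (monomial ([] @ [Ghost e] @ ghost_word es'))"
    by (rule monomial_rel[OF cong_head_Ghost]) (use awalk_arcs[OF assms(1)] in \<open>auto simp: es\<close>)
  then show ?thesis using assms(1) by (auto simp: es awalk_simps)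
qed

text \<open>The vertex left by $e^* e = r(e)$ is absorbed by the first edge of \<open>es\<close>,
  which is why \<open>es\<close> must be nonempty. Absorbing to the right lets \<open>fs\<close> be
  an arbitrary list of edges.\<close>

lemma ghost_Cons_edge_Cons:
  assumes "awalk u es v" "es \<noteq> []" "e \<in> arcs G" "head G e = u" "set fs \<subseteq> arcs G"
  shows "lpa_cong G (monomial (ghost_word (e # fs) @ edge_word (e # es)))
    (monomial (ghost_word fs @ edge_word es))"
proof -
  obtain e' es' where es: "es = e' # es'" using assms(2) by (cases es) auto
  have e': "e' \<in> arcs G" "tail G e' = u" "set es \<subseteq> arcs G"
    using assms(1) by (auto simp: es awalk_Cons_iff)
  have "lpa_cong G (monomial (ghost_word fs @ [Ghost e, Edge e] @ edge_word es))
      (monomial (ghost_word fs @ [Vert (head G e)] @ edge_word es))"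
    by (rule monomial_rel[OF cong_Ghost_Edge]) (use assms e' in auto)
  also have "lpa_cong G (monomial (ghost_word fs @ [Vert (tail G e'), Edge e'] @ edge_word es'))
      (monomial (ghost_word fs @ [Edge e'] @ edge_word es'))"
    by (rule monomial_rel[OF cong_tail_Edge]) (use assms e' in \<open>auto simp: es\<close>)
  then have "lpa_cong G (monomial (ghost_word fs @ [Vert (head G e)] @ edge_word es))
      (monomial (ghost_word fs @ edge_word es))"
    using e' assms(4) by (simp add: es)
  finally show ?thesis by simp
qed

lemma ghost_word_edge_word_same:
  assumes "awalk u es v" "es \<noteq> []"
  shows "lpa_cong G (monomial (ghost_word es @ edge_word es)) (monomial [Vert v])"
  using assms
proof (induction es arbitrary: u)
  case (Cons e es)
  then have e: "e \<in> arcs G" "awalk (head G e) es v" by (auto simp: awalk_Cons_iff)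
  show ?case
  proof (cases "es = []")
    case True
    then show ?thesis using e cong_Ghost_Edge[OF e(1)] by (simp add: awalk_Nil_iff)
  next
    case False
    have "lpa_cong G (monomial (ghost_word (e # es) @ edge_word (e # es)))
        (monomial (ghost_word es @ edge_word es))"
      by (rule ghost_Cons_edge_Cons[OF e(2) False e(1)]) (use e(2) in \<open>auto simp: awalk_def\<close>)
    also note Cons.IH[OF e(2) False]
    finally show ?thesis .
  qed
qed simp

text \<open>When neither list is a prefix of the other, they diverge at some position: the common
  beginning cancels and (CK1) for two distinct edges gives zero.\<close>

lemma ghost_word_edge_word_distinct:
  assumes "awalk u es v" "set fs \<subseteq> arcs G" "\<And>ds. es \<noteq> fs @ ds" "\<And>ds. fs \<noteq> es @ ds"
  shows "(monomial (ghost_word fs @ edge_word es) :: ('a, 'b, 'k::field) lpa_poly) \<in> lpa_ideal G"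
  using assms
proof (induction es arbitrary: u fs)
  case Nil
  from Nil(4)[of fs] show ?case by simp
next
  case (Cons e es)
  then have e: "e \<in> arcs G" "awalk (head G e) es v" by (auto simp: awalk_Cons_iff)
  obtain f fs' where fs: "fs = f # fs'" using Cons.prems(3)[of "e # es"] by (cases fs) auto
  show ?case
  proof (cases "e = f")
    case True
    have np: "es \<noteq> fs' @ ds" "fs' \<noteq> es @ ds" for ds
      using Cons.prems(3)[of ds] Cons.prems(4)[of ds] fs True by auto
    then have "es \<noteq> []" by force
    then have "lpa_cong G (monomial (ghost_word (e # fs') @ edge_word (e # es)))
        (monomial (ghost_word fs' @ edge_word es))"
      by (intro ghost_Cons_edge_Cons[OF e(2) _ e(1)]) (use Cons.prems fs in auto)
    moreover have "(monomial (ghost_word fs' @ edge_word es) :: ('a, 'b, 'k) lpa_poly) \<in> lpa_ideal G"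
      by (rule Cons.IH[OF e(2)]) (use np Cons.prems fs in auto)
    ultimately show ?thesis using lpa_cong_ideal fs True by blast
  next
    case False
    have "monomial (ghost_word fs' @ [Ghost f, Edge e] @ edge_word es) \<in> lpa_ideal G"
      by (rule monomial_rel_zero[OF Ghost_Edge_ideal])
         (use False Cons.prems fs e in \<open>auto simp: awalk_def\<close>)
    then show ?thesis by (simp add: fs)
  qed
qed

text \<open>One letter at a time: \<open>q'\<close> is the path produced by the action and
  \<open>k'\<close> the length of its segment in front of the unchanged tail. A ghost shortens the
  segment by one edge, whence \<open>k \<le> Suc k'\<close>; the bound \<open>1 < k\<close> keeps an
  edge in place to absorb the vertex that (CK1) creates.\<close>

lemma gen_act_edge_word:
  assumes "infinite_path G q" "g \<in> lpa_gens G" "1 < k"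
  shows "(gen_act G g q = (0 :: 'b stream \<Rightarrow>\<^sub>0 'k::field) \<and>
      (monomial (g # edge_word (stake k q)) :: ('a, 'b, 'k) lpa_poly) \<in> lpa_ideal G) \<or>
    (\<exists>q' k'. k \<le> Suc k' \<and> infinite_path G q' \<and>
      gen_act G g q = Poly_Mapping.single q' (1::'k) \<and> sdrop k' q' = sdrop k q \<and>
      lpa_cong G (monomial (g # edge_word (stake k q)) :: ('a, 'b, 'k) lpa_poly)
        (monomial (edge_word (stake k' q'))))"
    (is "?zero \<or> ?path")
proof -
  obtain e t where q: "q = e ## t" by (cases q)
  obtain m where k: "k = Suc m" "m \<noteq> 0" using assms(3) by (cases k) auto
  have e: "e \<in> arcs G" "head G e = path_source G t" "infinite_path G t"
    using assms(1) by (auto simp: q infinite_path_SCons_iff)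
  note arcs = set_edge_word[OF set_stake_arcs[OF e(3), of m]]
  have es: "edge_word (stake k q) = [Edge e] @ edge_word (stake m t)"
    by (simp add: q k)
  show ?thesis
  proof (cases g)
    case (Vert u)
    show ?thesis
    proof (cases "u = tail G e")
      case True
      have "lpa_cong G (monomial ([] @ [Vert (tail G e), Edge e] @ edge_word (stake m t)))
          (monomial ([] @ [Edge e] @ edge_word (stake m t)) :: ('a, 'b, 'k) lpa_poly)"
        by (rule monomial_rel[OF cong_tail_Edge]) (use e arcs in auto)
      then have ?path
        using True assms(1) by (intro exI[of _ q] exI[of _ k]) (simp add: Vert es, simp add: q)
      then show ?thesis ..
    next
      case False
      have "(monomial ([] @ [Vert u, Edge e] @ edge_word (stake m t)) :: ('a, 'b, 'k) lpa_poly) \<in> lpa_ideal G"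
        by (rule monomial_rel_zero[OF Vert_Edge_ideal]) (use e arcs False assms(2) in \<open>auto simp: Vert\<close>)
      then show ?thesis using False by (simp add: Vert es) (simp add: q)
    qed
  next
    case (Edge f)
    show ?thesis
    proof (cases "head G f = tail G e")
      case True
      then have ?path
        using assms(1,2)
        by (intro exI[of _ "f ## q"] exI[of _ "Suc k"])
           (auto simp: Edge infinite_path_SCons_iff lpa_ideal.zero q)
      then show ?thesis ..
    next
      case False
      have "(monomial ([] @ [Edge f, Edge e] @ edge_word (stake m t)) :: ('a, 'b, 'k) lpa_poly) \<in> lpa_ideal G"
        by (rule monomial_rel_zero[OF Edge_Edge_ideal]) (use e arcs False assms(2) in \<open>auto simp: Edge\<close>)
      then show ?thesis using False by (simp add: Edge es) (simp add: q)
    qed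
  next
    case (Ghost f)
    show ?thesis
    proof (cases "f = e")
      case True
      have "lpa_cong G (monomial (ghost_word [e] @ edge_word (e # stake m t)))
          (monomial (ghost_word [] @ edge_word (stake m t)) :: ('a, 'b, 'k) lpa_poly)"
        by (rule ghost_Cons_edge_Cons[OF infinite_path_awalk[OF e(3)]]) (use e k(2) in auto)
      then have ?path
        using True e by (intro exI[of _ t] exI[of _ m]) (simp add: Ghost q k)
      then show ?thesis ..
    next
      case False
      have "(monomial ([] @ [Ghost f, Edge e] @ edge_word (stake m t)) :: ('a, 'b, 'k) lpa_poly) \<in> lpa_ideal G"
        by (rule monomial_rel_zero[OF Ghost_Edge_ideal]) (use e arcs False assms(2) in \<open>auto simp: Ghost\<close>)
      then show ?thesis using False by (simp add: Ghost es) (simp add: q)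
    qed
  qed
qed

text \<open>Once the initial segment of \<open>q\<close> is longer than the word, multiplying the two in
  $L_K(E)$ mirrors the action of the word on \<open>q\<close>.\<close>

lemma word_act_edge_word:
  assumes "infinite_path G q" "set gs \<subseteq> lpa_gens G" "length gs < k"
  shows "(word_act G (Word gs) (Poly_Mapping.single q 1) = (0 :: 'b stream \<Rightarrow>\<^sub>0 'k::field) \<and>
      (monomial (gs @ edge_word (stake k q)) :: ('a, 'b, 'k) lpa_poly) \<in> lpa_ideal G) \<or>
    (\<exists>q' k'. k \<le> length gs + k' \<and> infinite_path G q' \<and>
      word_act G (Word gs) (Poly_Mapping.single q 1) = Poly_Mapping.single q' (1::'k) \<and>
      sdrop k' q' = sdrop k q \<and>
      lpa_cong G (monomial (gs @ edge_word (stake k q)) :: ('a, 'b, 'k) lpa_poly)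
        (monomial (edge_word (stake k' q'))))"
  using assms(2,3)
proof (induction gs)
  case Nil
  then show ?case
    using assms(1) by (intro disjI2 exI[of _ q] exI[of _ k]) (simp add: lpa_ideal.zero)
next
  case (Cons g gs)
  then have g: "g \<in> lpa_gens G" and IH: "set gs \<subseteq> lpa_gens G" "length gs < k" by auto
  let ?w = "monomial (gs @ edge_word (stake k q)) :: ('a, 'b, 'k) lpa_poly"
  have split: "monomial (g # gs @ edge_word (stake k q)) = monomial [g] * ?w"
    by (simp add: monomial_mult)
  have ug: "(monomial [g] :: ('a, 'b, 'k) lpa_poly) \<in> unital_alg G"
    using g by (simp add: unital_alg_monomial)
  from Cons.IH[OF IH] show ?case
  proof (elim disjE exE conjE)
    assume "word_act G (Word gs) (Poly_Mapping.single q 1) = (0 :: 'b stream \<Rightarrow>\<^sub>0 'k)"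
      and "?w \<in> lpa_ideal G"
    then show ?thesis
      using lpa_ideal_mult_left[OF _ ug] by (auto simp: split)
  next
    fix q' k'
    assume *: "k \<le> length gs + k'" "infinite_path G q'"
      "word_act G (Word gs) (Poly_Mapping.single q 1) = Poly_Mapping.single q' (1::'k)"
      "sdrop k' q' = sdrop k q" "lpa_cong G ?w (monomial (edge_word (stake k' q')))"
    \<comment> \<open>The letters of \<open>gs\<close> consumed at most \<open>length gs\<close>
      edges, and the segment was more than one edge longer than that.\<close>
    have "1 < k'" using *(1) Cons.prems(2) by simp
    have cong: "lpa_cong G (monomial (g # gs @ edge_word (stake k q)) :: ('a, 'b, 'k) lpa_poly)
        (monomial (g # edge_word (stake k' q')))"
      using lpa_cong_mult_left[OF *(5) ug] by (simp add: monomial_mult)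
    have act: "word_act G (Word (g # gs)) (Poly_Mapping.single q 1) = (gen_act G g q' :: 'b stream \<Rightarrow>\<^sub>0 'k)"
      using *(3) by simp
    from gen_act_edge_word[OF *(2) g \<open>1 < k'\<close>, where 'k = 'k] show ?thesis
    proof (elim disjE exE conjE)
      assume "gen_act G g q' = (0 :: 'b stream \<Rightarrow>\<^sub>0 'k)"
        and "(monomial (g # edge_word (stake k' q')) :: ('a, 'b, 'k) lpa_poly) \<in> lpa_ideal G"
      then show ?thesis using lpa_cong_ideal[OF cong] unfolding act by simp
    next
      fix q'' k''
      assume 2: "k' \<le> Suc k''" "infinite_path G q''"
        "gen_act G g q' = Poly_Mapping.single q'' (1::'k)" "sdrop k'' q'' = sdrop k' q'"
        "lpa_cong G (monomial (g # edge_word (stake k' q')) :: ('a, 'b, 'k) lpa_poly)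
          (monomial (edge_word (stake k'' q'')))"
      show ?thesis
        unfolding act using *(1,4) 2 lpa_cong_trans[OF cong 2(5)]
        by (intro disjI2 exI[of _ q''] exI[of _ k'']) simp
    qed
  qed
qed

section \<open>Irrational paths\<close>

text \<open>The equation makes \<open>t\<close> periodic with period \<open>length u\<close>, so an
  entry beyond the first block reduces to one at a smaller index.\<close>

lemma stream_eq_cycle:
  assumes "t = u @- t" "u \<noteq> []"
  shows "t = Stream.cycle u"
proof -
  have "t !! i = Stream.cycle u !! i" for i
  proof (induction i rule: less_induct)
    case (less i)
    have "i - length u < i" if "\<not> i < length u"
      using that assms(2) by (cases u) auto
    with less have "(u @- t) !! i = (u @- Stream.cycle u) !! i"
      by (simp add: shift_snth)
    then show ?case using assms(1) cycle_decomp[OF assms(2)] by metis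
  qed
  then show ?thesis using smap_alt[of id t "Stream.cycle u"] by (simp add: stream.map_id)
qed

lemma irrational_shift_inj:
  assumes "irrational G p" "ds @- sdrop n p = es @- sdrop n p"
  shows "ds = es"
proof -
  have *: "ds = es" if eq: "ds @- sdrop n p = es @- sdrop n p" and le: "length ds \<le> length es" for ds es
  proof -
    let ?t = "sdrop n p"
    have p: "infinite_path G p" using assms(1) by (simp add: irrational_def)
    have "ds = stake (length ds) (ds @- ?t)" by (simp add: stake_shift)
    also have "\<dots> = take (length ds) es" using eq le by (simp add: stake_shift)
    finally obtain cs where es: "es = ds @ cs" by (metis append_take_drop_id)
    have t: "?t = cs @- ?t" using eq by (simp add: es)
    have "cs = []"
    proof (rule ccontr)
      assume cs: "cs \<noteq> []"
      have cs': "stake (length cs) ?t = cs" "sdrop (length cs) ?t = ?t"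
        by (subst t, simp add: stake_shift sdrop_shift)+
      have "awalk (path_source G ?t) (stake (length cs) ?t) (path_source G (sdrop (length cs) ?t))"
        by (rule infinite_path_awalk[OF infinite_path_sdrop[OF p]])
      with cs have "closed_path G cs"
        unfolding cs' closed_path_def by blast
      moreover have "tail_equivalent p (Stream.cycle cs)"
        unfolding tail_equivalent_def using stream_eq_cycle[OF t cs]
        by (intro exI[of _ n] exI[of _ 0]) simp
      ultimately show False using assms(1) by (auto simp: irrational_def rational_def)
    qed
    then show ?thesis by (simp add: es)
  qed
  show ?thesis
    using *[of ds es] *[of es ds] assms(2) by (cases "length ds \<le> length es") auto
qed

text \<open>By irrationality, \<open>q = \<gamma> @- sdrop n p\<close> determines \<open>\<gamma>\<close>, so the initial segments can be
  recovered from the action on \<open>p\<close> by a linear map.\<close>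

lemma irrational_act_zero:
  fixes a :: "('a, 'b, 'k::field) lpa_poly"
  assumes "irrational G p" "a \<in> unital_alg G" "poly_act G a (Poly_Mapping.single p 1) = 0"
  obtains n where "a * monomial (edge_word (stake n p)) \<in> lpa_ideal G"
proof -
  have p: "infinite_path G p" using assms(1) by (simp add: irrational_def)
  have "finite ((\<lambda>w. case w of Word gs \<Rightarrow> length gs) ` Poly_Mapping.keys a)" by simp
  then obtain n where n: "\<And>w. w \<in> Poly_Mapping.keys a \<Longrightarrow> (case w of Word gs \<Rightarrow> length gs) < n"
    by (meson finite_nat_set_iff_bounded imageI)
  \<comment> \<open>The description is evaluated only at streams ending in the fixed tail of
    \<open>p\<close>; its value elsewhere is irrelevant.\<close>
  define \<Phi> :: "'b stream \<Rightarrow> ('a, 'b, 'k) lpa_poly"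
    where "\<Phi> q = monomial (edge_word (THE es. es @- sdrop (Suc n) p = q))" for q
  have \<Phi>: "\<Phi> q = monomial (edge_word (stake k q))" if "sdrop k q = sdrop (Suc n) p" for k q
  proof -
    have "(THE es. es @- sdrop (Suc n) p = q) = stake k q"
    proof (rule the_equality)
      show "stake k q @- sdrop (Suc n) p = q"
        using that stake_sdrop[of k q] by simp
    next
      fix es assume "es @- sdrop (Suc n) p = q"
      also have "q = stake k q @- sdrop (Suc n) p"
        using that stake_sdrop[of k q] by simp
      finally show "es = stake k q" by (rule irrational_shift_inj[OF assms(1)])
    qed
    then show ?thesis by (simp add: \<Phi>_def)
  qed
  let ?u = "monomial (edge_word (stake (Suc n) p)) :: ('a, 'b, 'k) lpa_poly"
  \<comment> \<open>Both sides are linear in \<open>a\<close>, so it suffices to treat words. Once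
    this is known, vanishing of the action forces the product into the ideal, with no independence
    statement about paths.\<close>
  have "lpa_cong G (a * ?u) (lin_ext \<Phi> (poly_act G a (Poly_Mapping.single p 1)))"
  proof (induction a rule: poly_mapping_linear_induct)
    case (single w c)
    then obtain gs where gs: "w = Word gs" "set gs \<subseteq> lpa_gens G"
      using assms(2) by (auto simp: mem_unital_alg)
    have "length gs < Suc n" using n[OF single] by (simp add: gs)
    from word_act_edge_word[OF p gs(2) this, where 'k = 'k]
    have "lpa_cong G (monomial (gs @ edge_word (stake (Suc n) p)))
        (lin_ext \<Phi> (word_act G (Word gs) (Poly_Mapping.single p 1)))"
      using \<Phi> by (elim disjE exE conjE) (simp_all del: stake.simps sdrop.simps word_act.simps)
    from lpa_cong_scale[OF this, of c] show ?case
      by (simp add: gs(1) single_eq_scale_monomial scale_mult_left monomial_mult poly_act_scale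
        lin_ext_scale del: stake.simps word_act.simps)
  qed (auto simp: lpa_ideal.zero poly_act_add lin_ext_add distrib_right
         simp del: stake.simps intro: lpa_cong_add)
  then have "a * ?u \<in> lpa_ideal G" by (simp add: assms(3) del: stake.simps)
  then show thesis by (rule that)
qed

section \<open>The kernel and its direct sum decomposition\<close>

lemma awalk_X_edges:
  assumes "infinite_path G p" "f \<in> X_edges G p i"
  shows "awalk (path_source G p) (stake i p @ [f]) (head G f)"
  using infinite_path_awalk[OF assms(1), of i] assms(2)
  by (auto simp: awalk_simps X_edges_def path_source_def)

lemma finite_X_edges:
  assumes "infinite_path G p" "\<not> infinite_emitter G (tail G (p !! i))"
  shows "finite (out_arcs G (tail G (p !! i)))" "finite (X_edges G p i)"
proof -
  show *: "finite (out_arcs G (tail G (p !! i)))"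
    using assms infinite_path_snth[OF assms(1), of i] by (auto simp: infinite_emitter_def)
  have "X_edges G p i \<subseteq> out_arcs G (tail G (p !! i))"
    by (auto simp: X_edges_def)
  then show "finite (X_edges G p i)" using * by (rule finite_subset)
qed

text \<open>The path $p_i f$ leaves $p$ exactly at its last edge. A prefix $p_j g$ with $j < i$
  would force $g = e_{j+1}$, and $j = i$ would force $f = g$.\<close>

lemma X_edges_incomparable:
  assumes "f \<in> X_edges G p i" "g \<in> X_edges G p j" "(i, f) \<noteq> (j, g)"
  shows "stake i p @ [f] \<noteq> (stake j p @ [g]) @ ds"
proof
  assume eq: "stake i p @ [f] = (stake j p @ [g]) @ ds"
  have "j \<le> i" using arg_cong[OF eq, of length] by simp
  show False
  proof (cases "j = i")
    case True
    then show False using eq assms(3) by simp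
  next
    case False
    then have "(stake i p @ [f]) ! j = p !! j" using \<open>j \<le> i\<close> by (simp add: nth_append)
    moreover have "((stake j p @ [g]) @ ds) ! j = g" by (simp add: nth_append)
    ultimately show False using eq assms(2) by (simp add: X_edges_def)
  qed
qed

text \<open>Represents $f^* p_i^*$ as the single ghost path $(p_i f)^*$. For $i = 0$ the vertex
  $p_0^*$ is left out, which (E2) permits.\<close>

definition J_gen :: "'b stream \<Rightarrow> nat \<Rightarrow> 'b \<Rightarrow> ('a, 'b, 'k::field) lpa_poly" where
  "J_gen p i f = monomial (ghost_word (stake i p @ [f]))"

definition J_set :: "'b stream \<Rightarrow> nat \<Rightarrow> ('a, 'b, 'k::field) lpa_poly set" where
  "J_set p i = set_sums (X_edges G p i) (\<lambda>f. {r * J_gen p i f |r. r \<in> carrier (free_alg G)})"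

lemma J_gen_carrier:
  "infinite_path G p \<Longrightarrow> f \<in> X_edges G p i \<Longrightarrow>
    (J_gen p i f :: ('a, 'b, 'k::field) lpa_poly) \<in> carrier (free_alg G)"
  unfolding J_gen_def using awalk_arcs[OF awalk_X_edges]
  by (intro free_alg_monomial set_ghost_word) auto

lemma J_set_zero: "0 \<in> J_set p i"
  unfolding J_set_def by (rule set_sums_zero)

lemma J_set_add:
  fixes x y :: "('a, 'b, 'k::field) lpa_poly"
  assumes "x \<in> J_set p i" "y \<in> J_set p i"
  shows "x + y \<in> J_set p i"
  using assms unfolding J_set_def
proof (rule set_sums_add[rotated 2])
  fix f
  show "0 \<in> {r * J_gen p i f |r. r \<in> carrier (free_alg G)}"
    using free_alg_zero by (metis (mono_tags, lifting) mem_Collect_eq mult_zero_left)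
  fix x y :: "('a, 'b, 'k) lpa_poly"
  assume "x \<in> {r * J_gen p i f |r. r \<in> carrier (free_alg G)}"
    "y \<in> {r * J_gen p i f |r. r \<in> carrier (free_alg G)}"
  then show "x + y \<in> {r * J_gen p i f |r. r \<in> carrier (free_alg G)}"
    by clarsimp (metis distrib_right free_alg_add)
qed

lemma J_set_scale:
  assumes "x \<in> J_set p i"
  shows "scale c x \<in> J_set p i"
  using assms unfolding J_set_def
  by (rule set_sums_map) (auto simp: scale_add_right simp flip: scale_mult_left intro: free_alg_scale)

lemma J_set_mult:
  assumes "x \<in> J_set p i" "a \<in> carrier (free_alg G)"
  shows "a * x \<in> J_set p i"
  using assms(1) unfolding J_set_def
  by (rule set_sums_map)
    (auto simp: distrib_left simp flip: mult.assoc intro: free_alg_mult[OF assms(2)])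

lemma J_set_carrier:
  assumes "infinite_path G p"
  shows "(J_set p i :: ('a, 'b, 'k::field) lpa_poly set) \<subseteq> carrier (free_alg G)"
  unfolding J_set_def
  by (rule set_sums_subset)
    (use J_gen_carrier[OF assms] in \<open>auto intro: free_alg_zero free_alg_add free_alg_mult\<close>)

lemma J_ideal_eq:
  fixes p :: "'b stream"
  assumes "infinite_path G p"
  shows "(J_ideal G p i :: ('a, 'b, 'k::field) lpa_elem set) = lpa_proj G ` J_set p i"
  unfolding J_ideal_def J_set_def
proof (rule ideal_sum_lpa_proj)
  fix f assume f: "f \<in> X_edges G p i"
  note J = J_gen_carrier[OF assms f, where 'k = 'k]
  have fa: "f \<in> arcs G" using f by (simp add: X_edges_def)
  let ?s = "star_word (path_source G p) (stake i p)"
  have v: "path_source G p \<in> verts G"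
    using infinite_path_snth[OF assms, of 0] by (simp add: path_source_def)
  have s: "?s \<noteq> []" "set ?s \<subseteq> lpa_gens G"
    using set_stake_arcs[OF assms, of i] v by (auto simp: star_word_def)
  have "lpa_word G [Ghost f] \<otimes>\<^bsub>lpa G\<^esub> lpa_word G ?s =
      (lpa_proj G (monomial (Ghost f # ?s)) :: ('a, 'b, 'k) lpa_elem)"
    using fa s by (simp add: lpa_word_eq lpa_mult free_alg_monomial monomial_mult)
  also have "\<dots> = lpa_proj G (J_gen p i f)"
  proof (cases i)
    case 0
    then have "tail G f = path_source G p" using f by (simp add: X_edges_def path_source_def)
    then show ?thesis
      using cong_Ghost_tail[OF fa] 0 by (simp add: lpa_proj_eq_iff J_gen_def star_word_def)
  next
    case (Suc k)
    then have "stake i p \<noteq> []" by simp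
    then show ?thesis by (simp add: J_gen_def star_word_def)
  qed
  finally show "PIdl\<^bsub>lpa G\<^esub> (lpa_word G [Ghost f] \<otimes>\<^bsub>lpa G\<^esub> lpa_word G ?s) =
      (lpa_proj G ` {r * J_gen p i f |r. r \<in> carrier (free_alg G)} :: ('a, 'b, 'k) lpa_elem set)"
    by (simp add: PIdl_lpa_proj[OF J])
  show "{r * J_gen p i f |r. r \<in> carrier (free_alg G)} \<subseteq> carrier (free_alg G)"
    using J_gen_carrier[OF assms f] by (auto intro: free_alg_mult)
qed

text \<open>This is $p_n p_n^*$ with the range of $p_n$ written in the middle. The vertex gives
  (CK2) something to rewrite and yields $s(p)$ at $n = 0$ without a separate case.\<close>

definition path_idem :: "'b stream \<Rightarrow> nat \<Rightarrow> ('a, 'b, 'k::field) lpa_poly" where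
  "path_idem p n =
    monomial (edge_word (stake n p) @ [Vert (tail G (p !! n))] @ ghost_word (stake n p))"

lemma path_idem_0: "path_idem p 0 = monomial [Vert (path_source G p)]"
  by (simp add: path_idem_def path_source_def)

lemma path_idem_Suc:
  assumes p: "infinite_path G p" and fin: "\<not> infinite_emitter G (tail G (p !! n))"
  shows "lpa_cong G (path_idem p n :: ('a, 'b, 'k::field) lpa_poly)
    (path_idem p (Suc n) + (\<Sum>f\<in>X_edges G p n. monomial (edge_word (stake n p @ [f])) * J_gen p n f))"
proof -
  let ?e = "p !! n" and ?E = "edge_word (stake n p)" and ?H = "ghost_word (stake n p)"
  have e: "?e \<in> arcs G" "head G ?e = tail G (p !! Suc n)"
    using p by (auto simp: infinite_path_def)
  note s = set_stake_arcs[OF p, of n]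
  define T :: "'b \<Rightarrow> ('a, 'b, 'k) lpa_poly"
    where "T f = monomial (?E @ [Edge f, Ghost f] @ ?H)" for f
  note fin = finite_X_edges[OF p fin]
  have out: "out_arcs G (tail G ?e) = insert ?e (X_edges G p n)" "?e \<notin> X_edges G p n"
    using e(1) by (auto simp: X_edges_def)
  have "lpa_cong G (monomial [Vert (tail G ?e)]) (\<Sum>f\<in>out_arcs G (tail G ?e). monomial [Edge f, Ghost f])"
    using e(1) fin(1) out by (intro lpa_ideal.relation lpa_relations.CK2) auto
  then have "lpa_cong G (monomial ?E * monomial [Vert (tail G ?e)] * monomial ?H)
      (monomial ?E * (\<Sum>f\<in>out_arcs G (tail G ?e). monomial [Edge f, Ghost f]) * monomial ?H)"
    by (rule lpa_cong_context) (use s in auto)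
  then have "lpa_cong G (path_idem p n) (\<Sum>f\<in>out_arcs G (tail G ?e). T f)"
    by (simp add: path_idem_def T_def sum_distrib_left sum_distrib_right monomial_mult)
  also have "(\<Sum>f\<in>out_arcs G (tail G ?e). T f) = T ?e + (\<Sum>f\<in>X_edges G p n. T f)"
    unfolding out(1) using fin(2) out(2) by simp
  also have "lpa_cong G (T ?e + (\<Sum>f\<in>X_edges G p n. T f)) (path_idem p (Suc n) + (\<Sum>f\<in>X_edges G p n. T f))"
  \<comment> \<open>The (CK2) summand of the edge on \<open>p\<close> lacks the middle vertex of the
    next idempotent; (E1) inserts it.\<close>
  proof (rule lpa_cong_add[OF lpa_cong_sym lpa_cong_refl])
    have "lpa_cong G (monomial (?E @ [Edge ?e, Vert (head G ?e)] @ Ghost ?e # ?H))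
        (monomial (?E @ [Edge ?e] @ Ghost ?e # ?H))"
      by (rule monomial_rel[OF cong_Edge_head]) (use e s in auto)
    then show "lpa_cong G (path_idem p (Suc n)) (T ?e)"
      by (simp add: path_idem_def T_def stake_Suc e del: stake.simps snth.simps)
  qed
  also have "(\<Sum>f\<in>X_edges G p n. T f) =
      (\<Sum>f\<in>X_edges G p n. monomial (edge_word (stake n p @ [f])) * J_gen p n f)"
    by (rule sum.cong) (simp_all add: T_def J_gen_def monomial_mult)
  finally show ?thesis .
qed

lemma path_idem_telescope:
  fixes a :: "('a, 'b, 'k::field) lpa_poly"
  assumes p: "infinite_path G p" and fin: "\<forall>i. \<not> infinite_emitter G (tail G (p !! i))"
    and a: "a \<in> carrier (free_alg G)"
  shows "\<exists>z\<in>set_sums UNIV (J_set p). lpa_cong G (a * path_idem p 0) (a * path_idem p n + z)"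
proof (induction n)
  case 0
  show ?case by (rule bexI[OF _ set_sums_zero]) (simp add: lpa_ideal.zero)
next
  case (Suc n)
  then obtain z :: "('a, 'b, 'k) lpa_poly" where z: "z \<in> set_sums UNIV (J_set p)"
    "lpa_cong G (a * path_idem p 0) (a * path_idem p n + z)" by blast
  let ?y = "\<Sum>f\<in>X_edges G p n. (a * monomial (edge_word (stake n p @ [f]))) * J_gen p n f"
  have "?y \<in> J_set p n"
    unfolding J_set_def
  proof (rule set_sumsI)
    show "finite (X_edges G p n)" using finite_X_edges(2)[OF p] fin by blast
    fix f assume f: "f \<in> X_edges G p n"
    have "a * monomial (edge_word (stake n p @ [f])) \<in> carrier (free_alg G)"
      using awalk_arcs[OF awalk_X_edges[OF p f]]
      by (intro free_alg_mult a free_alg_monomial set_edge_word) auto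
    then show "a * monomial (edge_word (stake n p @ [f])) * J_gen p n f
        \<in> {r * J_gen p n f |r. r \<in> carrier (free_alg G)}"
      by blast
  qed simp
  then have "?y \<in> set_sums UNIV (J_set p)" by (intro set_sums_member) auto
  then have "?y + z \<in> set_sums UNIV (J_set p)"
    using z(1) by (intro set_sums_add J_set_zero J_set_add)
  moreover have "lpa_cong G (a * path_idem p 0) (a * path_idem p (Suc n) + (?y + z))"
  proof -
    note z(2)
    also have "lpa_cong G (a * path_idem p n) (a * path_idem p (Suc n) + ?y)"
      using lpa_cong_mult_left[OF path_idem_Suc[OF p fin[rule_format]] free_alg_subset_unital[OF a]]
      by (simp add: distrib_left sum_distrib_left mult.assoc)
    then have "lpa_cong G (a * path_idem p n + z) (a * path_idem p (Suc n) + (?y + z))"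
      by (simp add: algebra_simps)
    finally show ?thesis .
  qed
  ultimately show ?case by blast
qed

lemma ghost_word_act:
  "word_act G (Word (ghost_word (stake i q))) (Poly_Mapping.single q 1) =
    (Poly_Mapping.single (sdrop i q) 1 :: 'b stream \<Rightarrow>\<^sub>0 'k::field)"
proof (induction i)
  case (Suc i)
  then show ?case by (simp add: stake_Suc del: stake.simps)
qed simp

lemma J_gen_act:
  assumes "f \<in> X_edges G p i"
  shows "poly_act G (J_gen p i f) (Poly_Mapping.single p 1) = (0 :: 'b stream \<Rightarrow>\<^sub>0 'k::field)"
  using assms ghost_word_act[of i p, where 'k = 'k] by (simp add: J_gen_def X_edges_def)

lemma J_gen_source:
  assumes "infinite_path G p" "f \<in> X_edges G p i"
  shows "lpa_cong G (J_gen p i f * monomial [Vert (path_source G p)]) (J_gen p i f)"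
  using ghost_word_Vert[OF awalk_X_edges[OF assms]] by (simp add: J_gen_def monomial_mult)

lemma ker_rho_eq:
  fixes p :: "'b stream"
  assumes p: "infinite_path G p" and irr: "irrational G p"
    and fin: "\<forall>i. \<not> infinite_emitter G (tail G (p !! i))"
  shows "(ker_rho G p :: ('a, 'b, 'k::field) lpa_elem set) = lpa_proj G ` set_sums UNIV (J_set p)"
proof -
  let ?v = "monomial [Vert (path_source G p)] :: ('a, 'b, 'k) lpa_poly"
  let ?p = "Poly_Mapping.single p 1 :: 'b stream \<Rightarrow>\<^sub>0 'k"
  have "path_source G p \<in> verts G"
    using infinite_path_snth[OF p, of 0] by (simp add: path_source_def)
  then have v: "?v \<in> carrier (free_alg G)" by (simp add: free_alg_monomial)
  have "ker_rho G p = {x \<in> PIdl\<^bsub>lpa G\<^esub> (lpa_proj G ?v). rho G p x = 0}"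
    by (simp add: ker_rho_def a_kernel_def kernel_def chen_module_def lpa_word_eq)
  also have "\<dots> = lpa_proj G ` {r * ?v |r. r \<in> carrier (free_alg G) \<and> poly_act G (r * ?v) ?p = 0}"
    unfolding PIdl_lpa_proj[OF v] by (auto simp: rho_lpa_proj[OF p] intro!: imageI)
  also have "\<dots> = lpa_proj G ` set_sums UNIV (J_set p)"
  proof (intro equalityI subsetI)
    fix x assume "x \<in> lpa_proj G ` {r * ?v |r. r \<in> carrier (free_alg G) \<and> poly_act G (r * ?v) ?p = 0}"
    then obtain a where a: "a \<in> carrier (free_alg G)" "poly_act G (a * ?v) ?p = 0"
      and x: "x = lpa_proj G (a * ?v)" by blast
    have "poly_act G a ?p = 0" using a(2) by (simp add: poly_act_mult)
    then obtain n where n: "a * monomial (edge_word (stake n p)) \<in> lpa_ideal G"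
      using irrational_act_zero[OF irr free_alg_subset_unital[OF a(1)]] by blast
    \<comment> \<open>Right multiplication by $p_n^*$ turns $a p_n = 0$ into $a p_n p_n^* = 0$, so
      only the correction terms of the telescoping remain.\<close>
    have "a * monomial (edge_word (stake n p)) * monomial ([Vert (tail G (p !! n))] @ ghost_word (stake n p))
        \<in> lpa_ideal G"
      using infinite_path_snth[OF p, of n] set_stake_arcs[OF p, of n]
      by (intro lpa_ideal_mult_right[OF n] unital_alg_monomial) auto
    then have idem: "a * path_idem p n \<in> lpa_ideal G"
      by (simp add: path_idem_def mult.assoc monomial_mult)
    obtain z where z: "z \<in> set_sums UNIV (J_set p)" "lpa_cong G (a * path_idem p 0) (a * path_idem p n + z)"
      using path_idem_telescope[OF p fin a(1)] by blast
    note z(2)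
    also have "lpa_cong G (a * path_idem p n + z) z" using idem by simp
    finally show "x \<in> lpa_proj G ` set_sums UNIV (J_set p)"
      using z(1) by (auto simp: x path_idem_0 lpa_proj_eq_iff intro!: image_eqI)
  next
    \<comment> \<open>The condition $x v = x$ encodes membership in $L_K(E)v$. Since
      \<open>S\<close> is additively closed, the reverse inclusion needs checking only on multiples
      of the generators.\<close>
    define S where "S = {x \<in> carrier (free_alg G). poly_act G x ?p = 0 \<and> lpa_cong G (x * ?v) x}"
    have S0: "0 \<in> S" by (simp add: S_def free_alg_zero lpa_ideal.zero)
    have S_add: "x + y \<in> S" if "x \<in> S" "y \<in> S" for x y
      using that lpa_cong_add[of "x * ?v" x G "y * ?v" y]
      by (simp add: S_def free_alg_add poly_act_add distrib_right)
    have S_gen: "r * J_gen p i f \<in> S" if "r \<in> carrier (free_alg G)" "f \<in> X_edges G p i" for r f i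
      using that J_gen_carrier[OF p that(2), where 'k = 'k]
        lpa_cong_mult_left[OF J_gen_source[OF p that(2)] free_alg_subset_unital[OF that(1)]]
      by (simp add: S_def free_alg_mult poly_act_mult J_gen_act mult.assoc)
    have "J_set p i \<subseteq> S" for i
      unfolding J_set_def by (rule set_sums_subset[OF S0 S_add]) (auto intro: S_gen)
    then have sub: "set_sums UNIV (J_set p) \<subseteq> S"
      by (intro set_sums_subset[OF S0 S_add])
    fix x :: "('a, 'b, 'k) lpa_elem"
    assume "x \<in> lpa_proj G ` set_sums UNIV (J_set p)"
    then obtain y where y: "y \<in> S" "x = lpa_proj G y" using sub by blast
    then have "x = lpa_proj G (y * ?v)" "poly_act G (y * ?v) ?p = 0"
      using lpa_cong_sym[of "y * ?v" y G] by (auto simp: S_def lpa_proj_eq_iff poly_act_mult)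
    with y(1) show "x \<in> lpa_proj G ` {r * ?v |r. r \<in> carrier (free_alg G) \<and> poly_act G (r * ?v) ?p = 0}"
      by (auto simp: S_def)
  qed
  finally show ?thesis .
qed

section \<open>Orthogonality and directness of the sum\<close>

lemma J_gen_edge_word:
  assumes "infinite_path G p" "f \<in> X_edges G p i" "g \<in> X_edges G p j" "(i, f) \<noteq> (j, g)"
  shows "J_gen p j g * monomial (edge_word (stake i p @ [f])) \<in> lpa_ideal G"
  unfolding J_gen_def monomial_mult
  by (rule ghost_word_edge_word_distinct[OF awalk_X_edges[OF assms(1,2)]
        awalk_arcs[OF awalk_X_edges[OF assms(1,3)]]])
    (use X_edges_incomparable[OF assms(2,3,4)] X_edges_incomparable[OF assms(3,2)] assms(4) in auto)

lemma J_gen_edge_word_same: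
  assumes "infinite_path G p" "f \<in> X_edges G p i"
  shows "lpa_cong G (J_gen p i f * monomial (edge_word (stake i p @ [f])) * J_gen p i f) (J_gen p i f)"
proof -
  note aw = awalk_X_edges[OF assms]
  have "lpa_cong G (monomial (ghost_word (stake i p @ [f]) @ edge_word (stake i p @ [f])))
      (monomial [Vert (head G f)])"
    by (rule ghost_word_edge_word_same[OF aw]) simp
  then have "lpa_cong G (J_gen p i f * monomial (edge_word (stake i p @ [f])) * J_gen p i f)
      (monomial [Vert (head G f)] * J_gen p i f)"
    unfolding J_gen_def monomial_mult[of "ghost_word _" "edge_word _"]
    by (rule lpa_cong_mult_right)
      (intro unital_alg_monomial set_ghost_word awalk_arcs[OF aw])
  also have "lpa_cong G (monomial [Vert (head G f)] * J_gen p i f) (J_gen p i f)"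
    using Vert_ghost_word[OF aw] by (simp add: J_gen_def monomial_mult)
  finally show ?thesis .
qed

text \<open>Right multiplication by $p_i f f^* p_i^*$ recovers the $f$-component of an element of
  $J_i(p)$ and kills every other $J_j(p)$.\<close>

lemma J_ideal_disjoint:
  fixes y :: "('a, 'b, 'k::field) lpa_poly"
  assumes p: "infinite_path G p" and x: "x \<in> J_set p i" and y: "y \<in> set_sums (UNIV - {i}) (J_set p)"
    and xy: "lpa_cong G x y"
  shows "x \<in> lpa_ideal G"
proof -
  define m where "m f = (monomial (edge_word (stake i p @ [f])) :: ('a, 'b, 'k) lpa_poly)" for f
  have m: "m f \<in> unital_alg G" if "f \<in> X_edges G p i" for f
    unfolding m_def using awalk_arcs[OF awalk_X_edges[OF p that]]
    by (intro unital_alg_monomial set_edge_word)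
  have y0: "y * m f \<in> lpa_ideal G" if f: "f \<in> X_edges G p i" for f
  proof -
    let ?S = "{y. y * m f \<in> lpa_ideal G}"
    have S: "0 \<in> ?S" "\<And>u w. u \<in> ?S \<Longrightarrow> w \<in> ?S \<Longrightarrow> u + w \<in> ?S"
      by (auto simp: distrib_right intro: lpa_ideal.zero lpa_ideal.add)
    have "J_set p j \<subseteq> ?S" if "j \<noteq> i" for j
      unfolding J_set_def
    proof (rule set_sums_subset[OF S])
      fix g assume g: "g \<in> X_edges G p j"
      have "J_gen p j g * m f \<in> lpa_ideal G"
        unfolding m_def using that by (intro J_gen_edge_word[OF p f g]) simp
      then show "{r * J_gen p j g |r. r \<in> carrier (free_alg G)} \<subseteq> ?S"
        by (auto simp: mult.assoc intro: lpa_ideal.left_mult)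
    qed
    then have "set_sums (UNIV - {i}) (J_set p) \<subseteq> ?S"
      by (intro set_sums_subset[OF S]) auto
    with y show ?thesis by blast
  qed
  have x0: "x * m f \<in> lpa_ideal G" if f: "f \<in> X_edges G p i" for f
    using lpa_cong_ideal[OF lpa_cong_mult_right[OF xy m[OF f]]] y0[OF f] by simp
  obtain B h where B: "finite B" "B \<subseteq> X_edges G p i"
    "\<forall>f\<in>B. h f \<in> {r * J_gen p i f |r. r \<in> carrier (free_alg G)}" and xB: "x = sum h B"
    using x unfolding J_set_def set_sums_def by blast
  from B(3) obtain r where r: "\<And>f. f \<in> B \<Longrightarrow> r f \<in> carrier (free_alg G) \<and> h f = r f * J_gen p i f"
    by (simp add: Bex_def) metis
  have "h f \<in> lpa_ideal G" if f: "f \<in> B" for f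
  proof -
    have fX: "f \<in> X_edges G p i" using f B(2) by blast
    have "(\<Sum>g\<in>B - {f}. h g * m f) \<in> lpa_ideal G"
    proof (rule lpa_ideal_sum)
      fix g assume g: "g \<in> B - {f}"
      then have "J_gen p i g * m f \<in> lpa_ideal G"
        unfolding m_def using B(2) by (intro J_gen_edge_word[OF p fX]) auto
      then show "h g * m f \<in> lpa_ideal G"
        using g r by (simp add: mult.assoc lpa_ideal.left_mult)
    qed
    \<comment> \<open>Orthogonality within level \<open>i\<close> isolates the summand of
      \<open>f\<close>, so each summand of \<open>x\<close> vanishes separately.\<close>
    moreover have "x * m f = h f * m f + (\<Sum>g\<in>B - {f}. h g * m f)"
      unfolding xB sum_distrib_right using B(1) f by (rule sum.remove)
    ultimately have "h f * m f \<in> lpa_ideal G"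
      using lpa_ideal_diff[OF x0[OF fX]] by (metis add_diff_cancel_right')
    then have "h f * m f * J_gen p i f \<in> lpa_ideal G"
      by (rule lpa_ideal_mult_right[OF _ free_alg_subset_unital[OF J_gen_carrier[OF p fX]]])
    then have "r f * (J_gen p i f * m f * J_gen p i f) \<in> lpa_ideal G"
      using r[OF f] by (simp add: mult.assoc)
    moreover have "lpa_cong G (r f * (J_gen p i f * m f * J_gen p i f)) (r f * J_gen p i f)"
      unfolding m_def using r[OF f]
      by (intro lpa_cong_mult_left[OF J_gen_edge_word_same[OF p fX]] free_alg_subset_unital) simp
    ultimately show ?thesis
      using lpa_cong_ideal r[OF f] by metis
  qed
  then show ?thesis unfolding xB by (rule lpa_ideal_sum)
qed

end

theorem corollary2p17:
  fixes E :: "('v, 'e) pre_digraph" and p :: "'e stream"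
  assumes "wf_digraph E"
    and "infinite_path E p" and "irrational E p"
    and "\<forall>i. \<not> infinite_emitter E (tail E (p !! i))"
  shows "internal_direct_sum (lpa E :: ('k::field, ('v, 'e, 'k) lpa_elem) module)
           (ker_rho E p) UNIV (J_ideal E p)"
proof -
  interpret wf_digraph E by (rule assms(1))
  note J = J_ideal_eq[OF assms(2), where 'k = 'k]
  note sub = J_set_carrier[OF assms(2), where 'k = 'k]
  have sum: "ideal_sum (lpa E) A (J_ideal E p) = lpa_proj E ` set_sums A (J_set p :: nat \<Rightarrow> ('v, 'e, 'k) lpa_poly set)"
    for A by (rule ideal_sum_lpa_proj[OF J sub])
  show ?thesis
    unfolding internal_direct_sum_def
  proof (intro conjI ballI)
    fix i
    show "left_ideal (lpa E) (J_ideal E p i :: ('v, 'e, 'k) lpa_elem set)"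
      unfolding J
      by (intro left_ideal_lpa_proj sub J_set_zero J_set_add J_set_scale J_set_mult)
    show "J_ideal E p i \<inter> ideal_sum (lpa E) (UNIV - {i}) (J_ideal E p) =
        {\<zero>\<^bsub>lpa E :: ('k, ('v, 'e, 'k) lpa_elem) module\<^esub>}"
      unfolding J sum
    proof (intro equalityI subsetI)
      fix z :: "('v, 'e, 'k) lpa_elem"
      assume "z \<in> lpa_proj E ` J_set p i \<inter> lpa_proj E ` set_sums (UNIV - {i}) (J_set p)"
      then obtain x y where xy: "x \<in> J_set p i" "y \<in> set_sums (UNIV - {i}) (J_set p)"
        and z: "z = lpa_proj E x" "z = lpa_proj E y" by blast
      \<comment> \<open>The representatives coming from the two sides agree only modulo the
        relations, so disjointness is applied in its congruence form.\<close>
      have "lpa_cong E x y" using z lpa_proj_eq_iff by metis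
      with xy have "x \<in> lpa_ideal E" by (rule J_ideal_disjoint[OF assms(2)])
      then show "z \<in> {\<zero>\<^bsub>lpa E\<^esub>}" by (simp add: z(1) lpa_zero lpa_proj_eq_iff)
    next
      fix z :: "('v, 'e, 'k) lpa_elem"
      assume "z \<in> {\<zero>\<^bsub>lpa E\<^esub>}"
      then show "z \<in> lpa_proj E ` J_set p i \<inter> lpa_proj E ` set_sums (UNIV - {i}) (J_set p)"
        using J_set_zero[of p i] set_sums_zero[of "UNIV - {i}" "J_set p"] by (auto simp: lpa_zero)
    qed
  next
    show "ker_rho E p = ideal_sum (lpa E :: ('k, ('v, 'e, 'k) lpa_elem) module) UNIV (J_ideal E p)"
      unfolding sum by (rule ker_rho_eq[OF assms(2-4)])
  qed
qed

end
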